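(* Let $I=\{1,\dots,n\}$ and let $(W,S)$ and $(W',S')$ be Coxeter systems with $S=\{s_1,\dots,s_n\}$ and $S'=\{s_1',\dots,s_n'\}$, so that $$W=\langle s_i\mid (s_is_j)^{m_{ij}}=1\rangle\quad\text{and}\quad W'=\langle s_i'\mid (s_i's_j')^{m'_{ij}}=1\rangle,\qquad i,j\in I.$$ Suppose that the matrices $(m_{ij})$ and $(m'_{ij})$ differ only in one pair of positions corresponding to indices $(p,q)$ and $(q,p)$, with both $m_{pq}$ and $m'_{pq}$ finite numbers $\ge 7$. Let $\iota\colon S\to S'$, $s_i\mapsto s_i'$, be the natural bijection. Then $\iota$ induces bijections $\Omega(S)\to\Omega(S')$, $\Psi(S)\to\Psi(S')$, and $\Lambda_k(S)\to\Lambda_k(S')$ for all $k\ge 0$. In particular, the hypergraph indexes of $(W,S)$ and $(W',S')$ are equal.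
   Context: In a Coxeter system $W=\langle S\mid (st)^{m_{st}}=1\rangle$ we have $S$ finite, $m_{ss}=1$ and $m_{st}=m_{ts}\in\{2,3,\dots\}\cup\{\infty\}$ for $s\neq t$ ($\infty$ meaning that $st$ has infinite order). For $T\subseteq S$, $W_T=\langle T\rangle$, and $(W_T,T)$ is a Coxeter system. $T$ is spherical if $W_T$ is finite and nonspherical otherwise; minimal nonspherical if it is nonspherical but all its proper subsets are spherical; irreducible if it has no nontrivial partition into two disjoint commuting subsets; affine if $(W_T,T)$ is affine, i.e. $T$ is the set of reflections in the faces of a compact polytope in Euclidean space. For $A,B\subseteq S$, $A\times B$ denotes $A\cup B$ where $A$ and $B$ are disjoint commuting subsets of $S$. Hypergraph index: The wide subsets $\Omega(S)$ are the maximal elements (under inclusion) of the collection of subsets of $S$ of the form $A\times B$ such that either $A$ and $B$ are both nonspherical, or $A$ is irreducible affine of cardinality $\ge 3$ and $B$ is spherical (possibly empty). The slab subsets $\Psi(S)$ are the maximal elements of the collection of subsets of $S$ of the form $A\times K$ where $A$ is minimal nonspherical, $K$ is a nonempty spherical subset commuting with $A$, and there is no $T\in\Omega(S)$ with $A\times K\subseteq T$. Put $\Lambda_{-1}(S)=\varnothing$ and $\Lambda_0(S)=\Omega(S)\cup\Psi(S)$. For $i\ge 0$ and $T,T'\in\Lambda_i(S)$, write $T\equiv_i T'$ if there are $T=T_0,T_1,\dots,T_k=T'$ in $\Lambda_i(S)$ with $T_j\cap T_{j+1}$ nonspherical for $0\le j<k$; then $\Lambda_{i+1}(S)$ is the set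 of all unions $\bigcup_{T\in C}T$ with $C$ an $\equiv_i$-equivalence class in $\Lambda_i(S)$. The hypergraph index is $h(W,S)=h\in\mathbb{N}\cup\{0\}$ if $S\in\Lambda_h(S)\setminus\Lambda_{h-1}(S)$ and $\Omega(S)\neq\varnothing$; if no such $h$ exists, or $\Omega(S)=\varnothing$, then $h(W,S)=\infty$. The maps induced by $\iota$ on sets of subsets send $T\subseteq S$ to $\iota(T)\subseteq S'$. *)

theory Defs
  imports
    "HOL-Library.Extended_Nat"
    "HOL-Algebra.Elementary_Groups"
    "HOL-Algebra.Bij"
    "Jordan_Normal_Form.Matrix"
begin

section \<open>Coxeter systems\<close>

text \<open>
  One relator of the presentation is inserted into, respectively deleted from, a word over \<open>S\<close>.
  Words have no inverse letters: as \<open>m s s = 1\<close>, the words \<open>[s, s]\<close> are among the relators, so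
  every generator is its own inverse. There is no relator for pairs with \<open>m s t = \<infinity>\<close>.
\<close>

inductive delete_relator :: "'a set \<Rightarrow> ('a \<Rightarrow> 'a \<Rightarrow> enat) \<Rightarrow> 'a list \<Rightarrow> 'a list \<Rightarrow> bool"
  for S :: "'a set" and m :: "'a \<Rightarrow> 'a \<Rightarrow> enat"
where
  "\<lbrakk>xs \<in> lists S; ys \<in> lists S; s \<in> S; t \<in> S; m s t = enat k\<rbrakk>
    \<Longrightarrow> delete_relator S m (xs @ concat (replicate k [s, t]) @ ys) (xs @ ys)"

definition word_eq :: "'a set \<Rightarrow> ('a \<Rightarrow> 'a \<Rightarrow> enat) \<Rightarrow> 'a list \<Rightarrow> 'a list \<Rightarrow> bool"
  where "word_eq S m = equivclp (delete_relator S m)"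

definition word_value :: "('a, 'c) monoid_scheme \<Rightarrow> 'a list \<Rightarrow> 'a"
  where "word_value W w = foldr (\<otimes>\<^bsub>W\<^esub>) w \<one>\<^bsub>W\<^esub>"

definition coxeter_matrix :: "'a set \<Rightarrow> ('a \<Rightarrow> 'a \<Rightarrow> enat) \<Rightarrow> bool"
  where "coxeter_matrix S m \<longleftrightarrow>
    (\<forall>s\<in>S. m s s = 1) \<and> (\<forall>s\<in>S. \<forall>t\<in>S. s \<noteq> t \<longrightarrow> m s t = m t s \<and> 2 \<le> m s t)"

text \<open>
  The last two conditions say that \<open>W\<close> is presented by the generators \<open>S\<close> and the relations
  \<open>(st)^m(s,t) = 1\<close>: \<open>S\<close> generates \<open>W\<close>, and the words with trivial value are exactly those that
  are trivial by virtue of the relations.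
\<close>

definition coxeter_system ::
    "('a, 'c) monoid_scheme \<Rightarrow> 'a set \<Rightarrow> ('a \<Rightarrow> 'a \<Rightarrow> enat) \<Rightarrow> bool"
  where "coxeter_system W S m \<longleftrightarrow>
    group W \<and> finite S \<and> S \<subseteq> carrier W \<and> coxeter_matrix S m \<and>
    generate W S = carrier W \<and>
    (\<forall>w\<in>lists S. word_value W w = \<one>\<^bsub>W\<^esub> \<longleftrightarrow> word_eq S m w [])"


section \<open>Spherical, irreducible and affine subsets\<close>

text \<open>The special subgroup generated by \<open>T\<close> is \<^term>\<open>subgroup_generated W T\<close>.\<close>

definition spherical :: "('a, 'c) monoid_scheme \<Rightarrow> 'a set \<Rightarrow> bool"
  where "spherical W T \<longleftrightarrow> finite (carrier (subgroup_generated W T))"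

definition minimal_nonspherical :: "('a, 'c) monoid_scheme \<Rightarrow> 'a set \<Rightarrow> bool"
  where "minimal_nonspherical W T \<longleftrightarrow> \<not> spherical W T \<and> (\<forall>U. U \<subset> T \<longrightarrow> spherical W U)"

definition disjoint_commuting :: "('a, 'c) monoid_scheme \<Rightarrow> 'a set \<Rightarrow> 'a set \<Rightarrow> bool"
  where "disjoint_commuting W A B \<longleftrightarrow>
    A \<inter> B = {} \<and> (\<forall>a\<in>A. \<forall>b\<in>B. a \<otimes>\<^bsub>W\<^esub> b = b \<otimes>\<^bsub>W\<^esub> a)"

definition irreducible_subset :: "('a, 'c) monoid_scheme \<Rightarrow> 'a set \<Rightarrow> bool"
  where "irreducible_subset W T \<longleftrightarrow>
    \<not> (\<exists>A B. A \<noteq> {} \<and> B \<noteq> {} \<and> A \<union> B = T \<and> disjoint_commuting W A B)"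

text \<open>
  Euclidean \<open>d\<close>-space is \<^term>\<open>carrier_vec d :: real vec set\<close>, so that the dimension can be
  quantified over. The reflection is in the hyperplane \<open>u \<bullet> x = c\<close> with unit normal \<open>u\<close>.
\<close>

definition hyperplane_reflection :: "nat \<Rightarrow> real vec \<Rightarrow> real \<Rightarrow> real vec \<Rightarrow> real vec"
  where "hyperplane_reflection d u c =
    (\<lambda>x \<in> carrier_vec d. x - (2 * (u \<bullet> x - c)) \<cdot>\<^sub>v u)"

definition halfspace_polytope :: "nat \<Rightarrow> 'a set \<Rightarrow> ('a \<Rightarrow> real vec) \<Rightarrow> ('a \<Rightarrow> real) \<Rightarrow> real vec set"
  where "halfspace_polytope d T u c = {x \<in> carrier_vec d. \<forall>t\<in>T. u t \<bullet> x \<le> c t}"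

definition polytope_interior :: "nat \<Rightarrow> 'a set \<Rightarrow> ('a \<Rightarrow> real vec) \<Rightarrow> ('a \<Rightarrow> real) \<Rightarrow> real vec set"
  where "polytope_interior d T u c = {x \<in> carrier_vec d. \<forall>t\<in>T. u t \<bullet> x < c t}"

text \<open>
  A compact \<open>d\<close>-dimensional convex polytope, given by half-spaces none of which is redundant. The
  last condition provides a point in the relative interior of the codimension-one face on each
  bounding hyperplane, so these faces correspond bijectively to the elements of \<open>T\<close>.
\<close>

definition compact_polytope :: "nat \<Rightarrow> 'a set \<Rightarrow> ('a \<Rightarrow> real vec) \<Rightarrow> ('a \<Rightarrow> real) \<Rightarrow> bool"
  where "compact_polytope d T u c \<longleftrightarrow>
    finite T \<and> (\<forall>t\<in>T. u t \<in> carrier_vec d \<and> u t \<bullet> u t = 1) \<and>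
    (\<exists>r. \<forall>x \<in> halfspace_polytope d T u c. x \<bullet> x \<le> r) \<and>
    polytope_interior d T u c \<noteq> {} \<and>
    (\<forall>t\<in>T. \<exists>x \<in> carrier_vec d. u t \<bullet> x = c t \<and> (\<forall>s \<in> T - {t}. u s \<bullet> x < c s))"

text \<open>
  \<open>(G, T)\<close> is affine if \<open>G\<close> is a geometric reflection group on some Euclidean space: the elements
  of \<open>T\<close> act as the reflections in the codimension-one faces of a compact polytope, and this polytope
  is a fundamental domain for \<open>G\<close>. The latter is part of the notion (it makes the action faithful
  and discrete, with \<open>T\<close> the reflections in the walls of a chamber).
\<close>

definition affine_coxeter :: "('a, 'c) monoid_scheme \<Rightarrow> 'a set \<Rightarrow> bool"
  where "affine_coxeter G T \<longleftrightarrow>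
    (\<exists>(d::nat) u c \<rho>.
      compact_polytope d T u c \<and>
      \<rho> \<in> hom G (BijGroup (carrier_vec d)) \<and>
      (\<forall>t\<in>T. \<rho> t = hyperplane_reflection d (u t) (c t)) \<and>
      (\<Union>g\<in>carrier G. \<rho> g ` halfspace_polytope d T u c) = carrier_vec d \<and>
      (\<forall>g\<in>carrier G. g \<noteq> \<one>\<^bsub>G\<^esub> \<longrightarrow>
        \<rho> g ` polytope_interior d T u c \<inter> polytope_interior d T u c = {}))"

definition affine_subset :: "('a, 'c) monoid_scheme \<Rightarrow> 'a set \<Rightarrow> bool"
  where "affine_subset W T \<longleftrightarrow> affine_coxeter (subgroup_generated W T) T"


section \<open>Hypergraph index\<close>

definition maximal_members :: "'a set set \<Rightarrow> 'a set set"
  where "maximal_members \<C> = {T \<in> \<C>. \<forall>U\<in>\<C>. T \<subseteq> U \<longrightarrow> U = T}"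

definition wide_subsets :: "('a, 'c) monoid_scheme \<Rightarrow> 'a set \<Rightarrow> 'a set set"
  where "wide_subsets W S = maximal_members
    {A \<union> B | A B. A \<subseteq> S \<and> B \<subseteq> S \<and> disjoint_commuting W A B \<and>
      (\<not> spherical W A \<and> \<not> spherical W B \<or>
       irreducible_subset W A \<and> affine_subset W A \<and> 3 \<le> card A \<and> spherical W B)}"

definition slab_subsets :: "('a, 'c) monoid_scheme \<Rightarrow> 'a set \<Rightarrow> 'a set set"
  where "slab_subsets W S = maximal_members
    {A \<union> K | A K. A \<subseteq> S \<and> K \<subseteq> S \<and> disjoint_commuting W A K \<and>
      minimal_nonspherical W A \<and> K \<noteq> {} \<and> spherical W K \<and>
      \<not> (\<exists>T \<in> wide_subsets W S. A \<union> K \<subseteq> T)}"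

definition merge_rel :: "('a, 'c) monoid_scheme \<Rightarrow> 'a set set \<Rightarrow> ('a set \<times> 'a set) set"
  where "merge_rel W L =
    {(T, T'). T \<in> L \<and> T' \<in> L \<and> \<not> spherical W (T \<inter> T')}\<^sup>* \<inter> (L \<times> L)"

fun Lambda :: "('a, 'c) monoid_scheme \<Rightarrow> 'a set \<Rightarrow> nat \<Rightarrow> 'a set set"
  where
    "Lambda W S 0 = wide_subsets W S \<union> slab_subsets W S"
  | "Lambda W S (Suc i) = Union ` (Lambda W S i // merge_rel W (Lambda W S i))"

text \<open>\<open>Lambda_pred W S h\<close> is the collection with index \<open>h - 1\<close>; the one with index \<open>-1\<close> is empty.\<close>

definition Lambda_pred :: "('a, 'c) monoid_scheme \<Rightarrow> 'a set \<Rightarrow> nat \<Rightarrow> 'a set set"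
  where "Lambda_pred W S h = (case h of 0 \<Rightarrow> {} | Suc i \<Rightarrow> Lambda W S i)"

text \<open>
  There is at most one admissible \<open>h\<close>: all members of the collections are nonspherical subsets of
  \<open>S\<close>, so once \<open>S\<close> belongs to one of them, all later ones are equal to \<open>{S}\<close>.
\<close>

definition hypergraph_index :: "('a, 'c) monoid_scheme \<Rightarrow> 'a set \<Rightarrow> enat"
  where "hypergraph_index W S =
    (if wide_subsets W S \<noteq> {} \<and> (\<exists>h. S \<in> Lambda W S h - Lambda_pred W S h)
     then enat (THE h. S \<in> Lambda W S h - Lambda_pred W S h)
     else \<infinity>)"

end

theory Submission
  imports Defs
begin

text \<open>
  The collections \<open>\<Omega>\<close>, \<open>\<Psi>\<close> and \<open>\<Lambda>\<^sub>k\<close> are built from inclusions, unions and intersections by means of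
  three pieces of data: which generators commute, which subsets of \<open>S\<close> are spherical, and which
  irreducible subsets with at least three elements are affine. So it is enough that the bijection \<open>\<iota>\<close>
  respects these three (\<open>commute_image_iff\<close>, \<open>spherical_image_iff\<close>, \<open>affine_image_iff\<close>).

  Distinct generators commute exactly when their label is \<open>2\<close>, so the changed label, which is at least
  \<open>7\<close> on both sides, is irrelevant for commutation. If a subset \<open>T\<close> does not contain both \<open>p\<close> and \<open>q\<close>,
  then \<open>T\<close> and \<open>\<iota>(T)\<close> carry the same labels. Since a special subgroup is determined by its labels
  (\<open>special_subgroup_iso\<close>), \<open>W\<^sub>T\<close> and \<open>W'\<^sub>T\<close> are then isomorphic by a map that extends \<open>\<iota>\<close>, and nothing
  changes. If \<open>T\<close> contains \<open>p\<close> and \<open>q\<close>, the label of \<open>p\<close>, \<open>q\<close> is too large to coexist with a third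
  generator \<open>t\<close> that fails to commute with, say, \<open>q\<close>. Let \<open>b\<close> be the bilinear form with
  \<open>b(s,t) = - cos (\<pi> / m(s,t))\<close>. Its value on the vector with coordinates \<open>\<surd>3\<close>, \<open>2\<close>, \<open>1\<close> at \<open>p\<close>, \<open>q\<close>, \<open>t\<close> is at
  most \<open>0\<close> as soon as \<open>m(p,q) \<ge> 6\<close>, and it is negative as soon as \<open>m(p,q) \<ge> 7\<close>.
  \<^item> If \<open>W\<^sub>T\<close> is finite, averaging yields an invariant form which is positive on this vector, and on \<open>p\<close>,
    \<open>q\<close>, \<open>t\<close> it is a positive multiple of \<open>b\<close>, a contradiction. Hence \<open>T\<close> is spherical exactly when \<open>{p,q}\<close>
    is a direct factor with a spherical complement (\<open>spherical_large_label_iff\<close>), a condition that does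
    not see the value of the label.
  \<^item> If \<open>T\<close> is affine, the unit normals \<open>u\<close> of the walls satisfy \<open>u(s) \<bullet> u(t) \<le> b(s,t)\<close>, and then the vector
    \<open>\<surd>3 u(p) + 2 u(q) + u(t)\<close> has negative square, which is absurd. So an irreducible \<open>T\<close> with at
    least three elements is affine on neither side (\<open>irreducible_large_label_not_affine\<close>). The bound \<open>7\<close>
    is sharp here: the triangle group with labels \<open>6\<close>, \<open>3\<close>, \<open>2\<close> is affine.

  Two facts on Coxeter groups carry this. The geometric representation is faithful on each special
  subgroup, already on the span of its own simple roots (\<open>faithful\<close>); this is Tits' argument with
  positive roots (\<open>ascent_positive\<close>). And two walls of a chamber that are not parallel enclose an angle
  \<open>\<pi>/k\<close> for which \<open>(st)\<^sup>k = 1\<close> (\<open>wall_angle\<close>). Both reduce to the group generated by two reflections,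
  where everything is expressed by the numbers \<open>sin (n\<theta>) / sin \<theta>\<close>.
\<close>

section \<open>Reflections acting on functions\<close>

text \<open>
  The geometric representation is used in its dual form. A function \<open>f\<close> stands for a linear form on the
  space with basis \<open>\<alpha>\<^sub>u\<close>, with \<open>f u\<close> its value at \<open>\<alpha>\<^sub>u\<close>, and \<open>reflect B s f\<close> is the composition of \<open>f\<close> with
  the reflection \<open>v \<mapsto> v - 2 B(\<alpha>\<^sub>s, v) \<alpha>\<^sub>s\<close>. No sums over the basis occur in this form, and the
  heights of a point of Euclidean space above a family of hyperplanes transform by the same formula.
  Words act on linear forms by composition, which reverses the order: the first letter acts first.
\<close>

definition reflect :: "('a \<Rightarrow> 'a \<Rightarrow> real) \<Rightarrow> 'a \<Rightarrow> ('a \<Rightarrow> real) \<Rightarrow> 'a \<Rightarrow> real"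
  where "reflect B s f = (\<lambda>u. f u - 2 * B s u * f s)"

definition act :: "('a \<Rightarrow> 'a \<Rightarrow> real) \<Rightarrow> 'a list \<Rightarrow> ('a \<Rightarrow> real) \<Rightarrow> 'a \<Rightarrow> real"
  where "act B w f = fold (reflect B) w f"

text \<open>
  Alternating words are built from their last letter, because the last letter of a word is the first
  to act on the simple roots.
\<close>

fun alt :: "'a \<Rightarrow> 'a \<Rightarrow> nat \<Rightarrow> 'a list"
  where
    "alt s t 0 = []"
  | "alt s t (Suc n) = alt t s n @ [t]"

text \<open>
  The Chebyshev polynomials of the second kind, shifted by one: \<open>cheb (cos \<theta>) n = sin (n\<theta>) / sin \<theta>\<close>.
  The recursion also covers the limit case \<open>\<theta> = 0\<close>, which belongs to the label \<open>\<infinity>\<close> and to parallel walls.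
\<close>

fun cheb :: "real \<Rightarrow> nat \<Rightarrow> real"
  where
    "cheb c 0 = 0"
  | "cheb c (Suc 0) = 1"
  | "cheb c (Suc (Suc n)) = 2 * c * cheb c (Suc n) - cheb c n"

lemma act_Nil [simp]: "act B [] f = f"
  by (simp add: act_def)

lemma act_Cons [simp]: "act B (s # w) f = act B w (reflect B s f)"
  by (simp add: act_def)

lemma act_append [simp]: "act B (v @ w) f = act B w (act B v f)"
  by (simp add: act_def)

lemma reflect_self: "B s s = 1 \<Longrightarrow> reflect B s f s = - f s"
  by (simp add: reflect_def)

lemma reflect_reflect: "B s s = 1 \<Longrightarrow> reflect B s (reflect B s f) = f"
  by (simp add: reflect_def)

lemma length_alt [simp]: "length (alt s t n) = n"
  by (induction n arbitrary: s t) auto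

lemma alt_in_lists: "s \<in> T \<Longrightarrow> t \<in> T \<Longrightarrow> alt s t n \<in> lists T"
  by (induction n arbitrary: s t) auto

lemma alt_add:
  "alt s t (j + n) = (if even n then alt s t j else alt t s j) @ alt s t n"
proof (induction n arbitrary: s t)
  case (Suc n)
  show ?case using Suc[of t s] by auto
qed simp

lemma alt_even: "alt s t (2 * k) = concat (replicate k [s, t])"
proof (induction k)
  case (Suc k)
  have "alt s t (2 * Suc k) = alt s t (2 + 2 * k)" by simp
  also have "\<dots> = alt s t 2 @ alt s t (2 * k)" by (subst alt_add) simp
  also have "alt s t 2 = [s, t]" by (simp add: numeral_2_eq_2)
  finally show ?case using Suc by simp
qed simp

lemma alt_Cons: "alt s t (Suc n) = (if even n then t else s) # alt s t n"
  using alt_add[of s t 1 n] by auto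

lemma cheb_sin: "sin \<theta> * cheb (cos \<theta>) n = sin (real n * \<theta>)"
proof (induction "cos \<theta>" n rule: cheb.induct)
  case (3 n)
  have "sin \<theta> * cheb (cos \<theta>) (Suc (Suc n)) =
      2 * cos \<theta> * (sin \<theta> * cheb (cos \<theta>) (Suc n)) - sin \<theta> * cheb (cos \<theta>) n"
    by (simp add: algebra_simps)
  also have "\<dots> = 2 * cos \<theta> * sin (real (Suc n) * \<theta>) - sin (real n * \<theta>)"
    using 3 by simp
  also have "\<dots> = sin (real (Suc n) * \<theta> + \<theta>)"
  proof -
    have "sin (real n * \<theta>) = sin (real (Suc n) * \<theta> - \<theta>)" by (simp add: algebra_simps)
    then show ?thesis by (simp only: sin_add sin_diff) simp
  qed
  finally show ?case by (simp add: algebra_simps)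
qed auto

lemma cheb_one: "cheb 1 n = real n"
  by (induction "1::real" n rule: cheb.induct) auto

text \<open>
  The root obtained from \<open>\<alpha>\<^sub>s\<close> by an alternating word has the coordinates \<open>cheb c (n + 1)\<close> and \<open>cheb c n\<close>; which of
  them belongs to \<open>\<alpha>\<^sub>s\<close> depends on the parity of \<open>n\<close>. Appending a letter is one step of the Chebyshev
  recursion, so the induction looks two steps back.
\<close>

lemma act_alt:
  assumes "B s s = 1" "B t t = 1" "B s t = - c" "B t s = - c"
  shows "act B (alt s t n) f s =
    cheb c (Suc n) * (if even n then f s else f t) + cheb c n * (if even n then f t else f s)"
proof -
  have "act B (alt s t n) f s =
      cheb c (Suc n) * (if even n then f s else f t) + cheb c n * (if even n then f t else f s) \<and>
    act B (alt s t (Suc n)) f s = cheb c (Suc (Suc n)) * (if even (Suc n) then f s else f t) +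
      cheb c (Suc n) * (if even (Suc n) then f t else f s)"
    if "B s s = 1" "B t t = 1" "B s t = - c" "B t s = - c" for s t
    using that
  proof (induction n arbitrary: s t)
    case 0
    then show ?case by (simp add: reflect_def)
  next
    case (Suc n)
    have IH1: "act B (alt t s (Suc n)) f t = cheb c (Suc (Suc n)) * (if even (Suc n) then f t else f s) +
        cheb c (Suc n) * (if even (Suc n) then f s else f t)"
      using Suc.IH[of t s] Suc.prems by simp
    have IH2: "act B (alt s t n) f s =
      cheb c (Suc n) * (if even n then f s else f t) + cheb c n * (if even n then f t else f s)"
      using Suc.IH[of s t] Suc.prems by blast
    have "act B (alt s t (Suc (Suc n))) f s =
        act B (alt t s (Suc n)) f s + 2 * c * act B (alt t s (Suc n)) f t"
      using Suc.prems by (simp add: reflect_def)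
    also have "act B (alt t s (Suc n)) f s = - act B (alt s t n) f s"
      using Suc.prems by (simp add: reflect_self)
    finally have eq: "act B (alt s t (Suc (Suc n))) f s =
        - act B (alt s t n) f s + 2 * c * act B (alt t s (Suc n)) f t" .
    have "act B (alt s t (Suc (Suc n))) f s =
       cheb c (Suc (Suc (Suc n))) * (if even (Suc (Suc n)) then f s else f t) +
       cheb c (Suc (Suc n)) * (if even (Suc (Suc n)) then f t else f s)"
      unfolding eq IH1 IH2 by (simp add: algebra_simps)
    then show ?case using Suc.IH[of s t] Suc.prems by blast
  qed
  then show ?thesis using assms by blast
qed

text \<open>
  If the form is nondegenerate on the plane spanned by \<open>\<alpha>\<^sub>s\<close> and \<open>\<alpha>\<^sub>t\<close>, every \<open>\<alpha>\<^sub>u\<close> is a vector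
  \<open>a \<alpha>\<^sub>s + b \<alpha>\<^sub>t\<close> of the plane plus a vector orthogonal to it, which both reflections fix. Thus the effect of
  a word in \<open>s\<close> and \<open>t\<close> on any coordinate is governed by its effect on the coordinates \<open>s\<close> and \<open>t\<close>.
\<close>

lemma reflect_pair_invariant:
  assumes "B s s = 1" "B t t = 1" "B s t = - c" "B t s = - c" "c\<^sup>2 \<noteq> 1"
  shows "\<exists>a b. \<forall>w \<in> lists {s, t}. \<forall>f.
    act B w f u - a * act B w f s - b * act B w f t = f u - a * f s - b * f t"
proof -
  define a where "a = (B s u + c * B t u) / (1 - c\<^sup>2)"
  define b where "b = (B t u + c * B s u) / (1 - c\<^sup>2)"
  have D: "1 - c\<^sup>2 \<noteq> 0" using assms by simp
  have a: "a - c * b = B s u" and b: "b - c * a = B t u"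
    unfolding a_def b_def using D by (simp_all add: divide_simps) (simp_all add: algebra_simps power2_eq_square)
  have 1: "reflect B s f u - a * reflect B s f s - b * reflect B s f t = f u - a * f s - b * f t" for f
    unfolding reflect_def a[symmetric] using assms by (simp add: algebra_simps)
  have 2: "reflect B t f u - a * reflect B t f s - b * reflect B t f t = f u - a * f s - b * f t" for f
    unfolding reflect_def b[symmetric] using assms by (simp add: algebra_simps)
  have "act B w f u - a * act B w f s - b * act B w f t = f u - a * f s - b * f t"
    if "w \<in> lists {s, t}" for w f
    using that by (induction w arbitrary: f) (auto simp: 1 2)
  then show ?thesis by blast
qed

text \<open>
  The product of the two reflections is a rotation by the angle \<open>2\<pi>/k\<close> in the plane of \<open>\<alpha>\<^sub>s\<close> and \<open>\<alpha>\<^sub>t\<close>.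
\<close>

lemma act_relator:
  assumes "B s s = 1" "B t t = 1" "B s t = - cos (pi / real k)" "B t s = - cos (pi / real k)" "2 \<le> k"
  shows "act B (concat (replicate k [s, t])) f = f"
proof -
  define \<theta> where "\<theta> = pi / real k"
  have \<theta>: "0 < \<theta>" "\<theta> < pi" and k\<theta>: "real k * \<theta> = pi"
    using assms(5) unfolding \<theta>_def by (auto simp: field_simps)
  have sin: "sin \<theta> > 0" using \<theta> by (rule sin_gt_zero)
  have c2: "(cos \<theta>)\<^sup>2 \<noteq> 1" 
  proof
    assume "(cos \<theta>)\<^sup>2 = 1"
    then have "(sin \<theta>)\<^sup>2 = 0" using sin_cos_squared_add[of \<theta>] by linarith
    then show False using sin by simp
  qed
  have U0: "cheb (cos \<theta>) (2 * k) = 0"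
  proof -
    have "sin (real (2 * k) * \<theta>) = sin (2 * pi)" using k\<theta> by (simp add: mult.assoc)
    then show ?thesis using cheb_sin[of \<theta> "2 * k"] sin by simp
  qed
  have U1: "cheb (cos \<theta>) (Suc (2 * k)) = 1"
  proof -
    have "real (Suc (2 * k)) * \<theta> = \<theta> + 2 * pi" using k\<theta> by (simp add: algebra_simps)
    then have "sin (real (Suc (2 * k)) * \<theta>) = sin \<theta>" by simp
    then show ?thesis using cheb_sin[of \<theta> "Suc (2 * k)"] sin by simp
  qed
  obtain j where j: "2 * k = Suc j" using assms(5) by (cases "2 * k") auto
  then have "even (Suc j)" by (metis dvd_triv_left)
  then have "odd j" by simp
  have Um: "cheb (cos \<theta>) j = - 1"
    using U0 U1 unfolding j by simp
  note B = assms(1-4)[folded \<theta>_def]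
  have w: "concat (replicate k [s, t]) = alt s t (2 * k)" by (simp add: alt_even)
  have s: "act B (alt s t (2 * k)) f s = f s"
    using act_alt[where c = "cos \<theta>" and B = B and s = s and t = t and n = "2 * k"] B U0 U1 by simp
  have "act B (alt s t (2 * k)) f t = - act B (alt t s j) f t"
    using B by (simp add: j reflect_self)
  also have "\<dots> = f t"
    using act_alt[where c = "cos \<theta>" and B = B and s = t and t = s and n = j] B U0 Um j \<open>odd j\<close> by simp
  finally have t: "act B (alt s t (2 * k)) f t = f t" .
  show ?thesis
  proof
    fix u
    obtain a b where "\<forall>w \<in> lists {s, t}. \<forall>f.
        act B w f u - a * act B w f s - b * act B w f t = f u - a * f s - b * f t"
      using reflect_pair_invariant[of B s t "cos \<theta>" u] B c2 by blast
    then have "act B (alt s t (2 * k)) f u - a * act B (alt s t (2 * k)) f s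
        - b * act B (alt s t (2 * k)) f t = f u - a * f s - b * f t"
      by (simp add: alt_in_lists)
    then show "act B (concat (replicate k [s, t])) f u = f u" using s t w by simp
  qed
qed

text \<open>
  The rotation by \<open>2\<pi>/k\<close> has order exactly \<open>k\<close>: if its \<open>j\<close>-th power is trivial, then \<open>cos (2j\<theta>) = 1\<close> for
  \<open>\<theta> = \<pi>/k\<close>, which is impossible while \<open>0 < j\<theta> < \<pi>\<close>.
\<close>

lemma relator_order:
  assumes "B s s = 1" "B t t = 1" "B s t = - cos (pi / real k)" "B t s = - cos (pi / real k)" "2 \<le> k"
    and triv: "\<And>f. act B (concat (replicate j [s, t])) f = f" and "1 \<le> j"
  shows "k \<le> j"
proof (rule ccontr)
  assume "\<not> k \<le> j"
  define \<theta> where "\<theta> = pi / real k"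
  have \<theta>: "0 < \<theta>" "\<theta> < pi" and j\<theta>: "0 < real j * \<theta>" "real j * \<theta> < pi"
    using assms \<open>\<not> k \<le> j\<close> unfolding \<theta>_def by (auto simp: field_simps)
  have sin: "sin \<theta> > 0" using \<theta> by (rule sin_gt_zero)
  have neq: "s \<noteq> t"
  proof
    assume "s = t"
    then have "cos \<theta> = - 1" using assms(1,3) \<theta>_def by simp
    then have "(sin \<theta>)\<^sup>2 = 0" using sin_cos_squared_add[of \<theta>] by simp
    then show False using sin by simp
  qed
  note B = assms(1-4)[folded \<theta>_def]
  have eq: "f s = cheb (cos \<theta>) (Suc (2 * j)) * f s + cheb (cos \<theta>) (2 * j) * f t" for f
    using act_alt[where c = "cos \<theta>" and B = B and s = s and t = t and n = "2 * j" and f = f] B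
      triv[of f] alt_even[of s t j] by simp
  have U0: "cheb (cos \<theta>) (2 * j) = 0" using eq[of "(\<lambda>_. 0)(t := 1)"] neq by simp
  have U1: "cheb (cos \<theta>) (Suc (2 * j)) = 1" using eq[of "(\<lambda>_. 0)(s := 1)"] neq by simp
  have "sin (real (2 * j) * \<theta>) = 0" using cheb_sin[of \<theta> "2 * j"] U0 by simp
  moreover have "sin (real (2 * j) * \<theta> + \<theta>) = sin \<theta>"
    using cheb_sin[of \<theta> "Suc (2 * j)"] U1 by (simp add: algebra_simps)
  ultimately have "cos (2 * (real j * \<theta>)) = 1" using sin by (simp add: sin_add mult.assoc)
  then have "sin (real j * \<theta>) = 0" by (simp add: cos_double_sin)
  then show False using sin_gt_zero[OF j\<theta>] by simp
qed

lemma relator_infinite: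
  assumes "B s s = 1" "B t t = 1" "B s t = - 1" "B t s = - 1"
    and triv: "\<And>f. act B (concat (replicate j [s, t])) f = f" 
  shows "j = 0"
proof -
  have neq: "s \<noteq> t" using assms by auto
  have eq: "f s = cheb 1 (Suc (2 * j)) * f s + cheb 1 (2 * j) * f t" for f
    using act_alt[where c = 1 and B = B and s = s and t = t and n = "2 * j" and f = f] assms(1-4)
      triv[of f] alt_even[of s t j] by simp
  show ?thesis using eq[of "(\<lambda>_. 0)(t := 1)"] neq by (simp add: cheb_one)
qed

section \<open>Words in a Coxeter system\<close>

text \<open>
  Membership in \<^term>\<open>lists S\<close> stays folded, so that it matches the premises of the lemmas below.
\<close>

declare in_listsD [rule del] in_listsI [rule del]

lemma rev_in_lists [simp]: "rev w \<in> lists T \<longleftrightarrow> w \<in> lists T"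
  by (simp add: in_lists_conv_set)

lemma relator_in_lists: "s \<in> T \<Longrightarrow> t \<in> T \<Longrightarrow> concat (replicate k [s, t]) \<in> lists T"
  by (induction k) auto

definition cos_matrix :: "('a \<Rightarrow> 'a \<Rightarrow> enat) \<Rightarrow> 'a \<Rightarrow> 'a \<Rightarrow> real"
  where "cos_matrix m s t = (case m s t of enat k \<Rightarrow> - cos (pi / real k) | \<infinity> \<Rightarrow> - 1)"

locale coxeter =
  fixes W :: "('a, 'c) monoid_scheme" (structure) and S :: "'a set" and m :: "'a \<Rightarrow> 'a \<Rightarrow> enat"
  assumes system: "coxeter_system W S m"
begin

sublocale group W
  using system by (simp add: coxeter_system_def)

abbreviation val :: "'a list \<Rightarrow> 'a"
  where "val \<equiv> word_value W"

abbreviation B :: "'a \<Rightarrow> 'a \<Rightarrow> real"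
  where "B \<equiv> cos_matrix m"

lemma S_carrier: "S \<subseteq> carrier W"
  using system by (simp add: coxeter_system_def)

lemma in_carrier: "s \<in> S \<Longrightarrow> s \<in> carrier W"
  using S_carrier by blast

lemma m_self: "s \<in> S \<Longrightarrow> m s s = 1"
  using system by (simp add: coxeter_system_def coxeter_matrix_def)

lemma m_sym: "s \<in> S \<Longrightarrow> t \<in> S \<Longrightarrow> m s t = m t s"
  using system unfolding coxeter_system_def coxeter_matrix_def by (cases "s = t") auto

lemma m_ge_2: "s \<in> S \<Longrightarrow> t \<in> S \<Longrightarrow> s \<noteq> t \<Longrightarrow> 2 \<le> m s t"
  using system by (simp add: coxeter_system_def coxeter_matrix_def)

lemma B_self: "s \<in> S \<Longrightarrow> B s s = 1"
  by (simp add: cos_matrix_def m_self one_enat_def)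

lemma B_sym: "s \<in> S \<Longrightarrow> t \<in> S \<Longrightarrow> B s t = B t s"
  by (simp add: cos_matrix_def m_sym)

lemma word_value_Nil [simp]: "val [] = \<one>"
  by (simp add: word_value_def)

lemma word_value_Cons [simp]: "val (s # w) = s \<otimes> val w"
  by (simp add: word_value_def)

lemma word_value_closed [simp]: "w \<in> lists S \<Longrightarrow> val w \<in> carrier W"
  by (induction w) (auto simp: in_carrier)

lemma word_value_append [simp]:
  "v \<in> lists S \<Longrightarrow> w \<in> lists S \<Longrightarrow> val (v @ w) = val v \<otimes> val w"
  by (induction v) (auto simp: in_carrier m_assoc)

lemma trivial_iff_word_eq: "w \<in> lists S \<Longrightarrow> val w = \<one> \<longleftrightarrow> word_eq S m w []"
  using system by (simp add: coxeter_system_def)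

lemma relator_trivial:
  assumes "s \<in> S" "t \<in> S" "m s t = enat k"
  shows "val (concat (replicate k [s, t])) = \<one>"
proof -
  have "delete_relator S m ([] @ concat (replicate k [s, t]) @ []) ([] @ [])"
    using assms by (intro delete_relator.intros) auto
  then have "word_eq S m (concat (replicate k [s, t])) []"
    unfolding word_eq_def by auto
  moreover have "concat (replicate k [s, t]) \<in> lists S"
    using assms by (intro relator_in_lists)
  ultimately show ?thesis by (simp add: trivial_iff_word_eq)
qed

lemma generator_squared: "s \<in> S \<Longrightarrow> s \<otimes> s = \<one>"
  using relator_trivial[of s s 1] by (simp add: m_self one_enat_def in_carrier)

lemma word_value_rev: "w \<in> lists S \<Longrightarrow> val w \<otimes> val (rev w) = \<one>"
proof (induction w)
  case (Cons s w)
  have "val (s # w) \<otimes> val (rev (s # w)) = s \<otimes> (val w \<otimes> val (rev w)) \<otimes> s"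
    using Cons.prems by (simp add: in_carrier m_assoc)
  also have "\<dots> = \<one>"
    using Cons by (simp add: in_carrier generator_squared)
  finally show ?case .
qed simp

lemma word_value_rev_inv: "w \<in> lists S \<Longrightarrow> val (rev w) = inv (val w)"
  using word_value_rev[of w] by (intro inv_equality[symmetric] inv_comm[of "val w"]) auto

text \<open>
  The geometric representation and the parity of the length respect the relations, because every
  relator acts trivially and has even length.
\<close>

lemma act_delete_relator:
  assumes "delete_relator S m v w"
  shows "act B v f = act B w f \<and> even (length v) = even (length w)"
  using assms
proof cases
  case (1 xs ys s t k)
  have "act B (concat (replicate k [s, t])) g = g" for g
  proof (cases "s = t")
    case True
    then have "k = 1" using 1 m_self[of s] by (simp add: one_enat_def)
    then show ?thesis using True 1 by (simp add: reflect_reflect B_self)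
  next
    case False
    then have "2 \<le> k" using m_ge_2[of s t] 1 by (simp add: numeral_eq_enat)
    then show ?thesis
      using 1 m_sym[of s t] by (intro act_relator) (auto simp: B_self, auto simp: cos_matrix_def)
  qed
  moreover have "length (concat (replicate k [s, t])) = 2 * k"
    by (induction k) auto
  ultimately show ?thesis unfolding 1 by simp
qed

lemma trivial_word:
  assumes "w \<in> lists S" "val w = \<one>"
  shows "act B w f = f" and "even (length w)"
proof -
  have "equivclp (delete_relator S m) w []"
    using assms by (simp add: trivial_iff_word_eq word_eq_def)
  then have "act B [] f = act B w f \<and> even (length ([] :: 'a list)) = even (length w)"
  proof (induction rule: equivclp_induct)
    case (step y z)
    then show ?case using act_delete_relator by metis
  qed simp
  then show "act B w f = f" "even (length w)" by auto
qed

text \<open>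
  By this lemma, elements of \<open>W\<close> may be replaced by arbitrary words that represent them. The action is
  compared by composing with the trivial words \<open>w v\<inverse>\<close> and \<open>v\<inverse> v\<close>, where \<open>rev v\<close> represents \<open>v\<inverse>\<close>.
\<close>

lemma same_value:
  assumes "v \<in> lists S" "w \<in> lists S" "val v = val w"
  shows "act B v f = act B w f" and "even (length v) \<longleftrightarrow> even (length w)"
proof -
  have "val (w @ rev v) = \<one>" "w @ rev v \<in> lists S" 
    using assms word_value_rev[of v] by simp_all
  note 1 = trivial_word[OF this(2,1)]
  have "val (rev v @ v) = \<one>" "rev v @ v \<in> lists S"
    using assms word_value_rev[of "rev v"] by simp_all
  note 2 = trivial_word[OF this(2,1)]
  have "act B v f = act B v (act B (w @ rev v) f)" using 1 by simp
  also have "\<dots> = act B (rev v @ v) (act B w f)" by simp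
  also have "\<dots> = act B w f" using 2 by simp
  finally show "act B v f = act B w f" .
  show "even (length v) \<longleftrightarrow> even (length w)" using 1(2) by auto
qed

text \<open>
  The label \<open>m(s,t)\<close> is the order of \<open>st\<close>. The relations only say that the order divides the label; that
  it is not smaller is seen in the geometric representation.
\<close>

lemma order_ge_m:
  assumes "s \<in> S" "t \<in> S" "s \<noteq> t" "val (concat (replicate k [s, t])) = \<one>" "1 \<le> k"
  shows "m s t \<le> enat k"
proof -
  have "concat (replicate k [s, t]) \<in> lists S" using assms by (intro relator_in_lists)
  then have triv: "act B (concat (replicate k [s, t])) f = f" for f
    using assms trivial_word by blast
  have sym: "m t s = m s t" using assms by (intro m_sym)
  show ?thesis
  proof (cases "m s t")
    case (enat j)
    then have "2 \<le> j" using m_ge_2[of s t] assms by (simp add: numeral_eq_enat)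
    then have "j \<le> k"
      using assms enat sym
      by - (rule relator_order[of B s t, OF _ _ _ _ _ triv], auto simp: B_self, auto simp: cos_matrix_def)
    then show ?thesis using enat by simp
  next
    case infinity
    then have "k = 0"
      using assms infinity sym
      by (intro relator_infinite[of B s t, OF _ _ _ _ triv]) (auto simp: B_self, auto simp: cos_matrix_def)
    then show ?thesis using assms by simp
  qed
qed

lemma commute_iff:
  assumes "s \<in> S" "t \<in> S" "s \<noteq> t"
  shows "s \<otimes> t = t \<otimes> s \<longleftrightarrow> m s t = 2"
proof -
  have c: "s \<in> carrier W" "t \<in> carrier W" using assms in_carrier by auto
  have eq: "val (concat (replicate 2 [s, t])) = (s \<otimes> t) \<otimes> (s \<otimes> t)"
    using c by (simp add: numeral_2_eq_2 m_assoc)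
  have inv: "inv (s \<otimes> t) = t \<otimes> s"
  proof -
    have "inv s = s" "inv t = t" using c generator_squared assms by (auto intro: inv_equality)
    then show ?thesis using c by (simp add: inv_mult_group)
  qed
  show ?thesis
  proof
    assume "s \<otimes> t = t \<otimes> s"
    then have "(s \<otimes> t) \<otimes> (s \<otimes> t) = \<one>" using inv c by (metis m_closed r_inv)
    then have "m s t \<le> enat 2" using eq order_ge_m[of s t 2] assms by simp
    then show "m s t = 2" using m_ge_2[of s t] assms by (simp add: numeral_eq_enat)
  next
    assume "m s t = 2"
    then have "(s \<otimes> t) \<otimes> (s \<otimes> t) = \<one>"
      using relator_trivial[of s t 2] eq assms by (simp add: numeral_eq_enat)
    then have "inv (s \<otimes> t) = s \<otimes> t" using c by (intro inv_equality) auto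
    then show "s \<otimes> t = t \<otimes> s" using inv by simp
  qed
qed

lemma B_le:
  assumes "enat k \<le> m s t" "1 \<le> k"
  shows "B s t \<le> - cos (pi / real k)"
proof (cases "m s t")
  case (enat j)
  then have "k \<le> j" using assms by simp
  then have "pi / real j \<le> pi / real k" "pi / real k \<le> pi" "0 \<le> pi / real j"
    using assms(2) by (auto simp: field_simps)
  then have "cos (pi / real k) \<le> cos (pi / real j)" using cos_monotone_0_pi_le by blast
  then show ?thesis using enat by (simp add: cos_matrix_def)
qed (simp add: cos_matrix_def)

lemma B_nonpos: "s \<in> S \<Longrightarrow> t \<in> S \<Longrightarrow> s \<noteq> t \<Longrightarrow> B s t \<le> 0"
  using B_le[of 2 s t] m_ge_2[of s t] by (simp add: numeral_eq_enat)

section \<open>Special subgroups\<close>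

lemma special_carrier:
  assumes "T \<subseteq> S"
  shows "carrier (subgroup_generated W T) = val ` lists T"
proof
  have T: "carrier W \<inter> T = T" using assms S_carrier by blast
  show "carrier (subgroup_generated W T) \<subseteq> val ` lists T"
  proof
    fix x assume "x \<in> carrier (subgroup_generated W T)"
    then have "x \<in> generate W T" by (simp add: carrier_subgroup_generated T)
    then show "x \<in> val ` lists T"
    proof induction
      case one
      have "val [] = \<one>" "[] \<in> lists T" by auto
      then show ?case by (metis imageI)
    next
      case (incl h)
      then have "val [h] = h" "[h] \<in> lists T" using assms by (auto simp: in_carrier)
      then show ?case by (metis imageI)
    next
      case (inv h)
      then have "val [h] = inv h" "[h] \<in> lists T"
        using assms by (auto simp: in_carrier intro!: inv_equality[symmetric] generator_squared)
      then show ?case by (metis imageI)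
    next
      case (eng x y)
      then obtain v w where "x = val v" "v \<in> lists T" "y = val w" "w \<in> lists T" by auto
      moreover then have "x \<otimes> y = val (v @ w)" using assms lists_mono[of T S] by (auto simp: subset_iff)
      ultimately show ?case by (metis append_in_lists_conv imageI)
    qed
  qed
  have "val w \<in> generate W T" if "w \<in> lists T" for w
    using that by (induction w) (auto intro: generate.intros)
  then show "val ` lists T \<subseteq> carrier (subgroup_generated W T)"
    by (auto simp: carrier_subgroup_generated T)
qed

text \<open>
  Lengths are measured within \<open>T\<close>. It is not known beforehand that a word over \<open>T\<close> which is as short as
  possible among the words over \<open>T\<close> is also as short as possible among the words over \<open>S\<close>; working with
  the former avoids the question.
\<close>

definition reduced :: "'a set \<Rightarrow> 'a list \<Rightarrow> bool"
  where "reduced T w \<longleftrightarrow> w \<in> lists T \<and> (\<forall>v \<in> lists T. val v = val w \<longrightarrow> length w \<le> length v)"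

lemma reduced_lists: "reduced T w \<Longrightarrow> w \<in> lists T"
  by (simp add: reduced_def)

lemma reducedD: "reduced T w \<Longrightarrow> v \<in> lists T \<Longrightarrow> val v = val w \<Longrightarrow> length w \<le> length v"
  by (simp add: reduced_def)

lemma reduced_exists:
  assumes "w \<in> lists T"
  obtains v where "reduced T v" "val v = val w"
proof -
  define v where "v = arg_min length (\<lambda>v. v \<in> lists T \<and> val v = val w)"
  have "v \<in> lists T \<and> val v = val w"
    unfolding v_def by (rule arg_min_natI[of _ w]) (use assms in auto)
  moreover have "length v \<le> length u" if "u \<in> lists T" "val u = val v" for u
    using arg_min_nat_le[of "\<lambda>v. v \<in> lists T \<and> val v = val w" u length] that calculation
    unfolding v_def by auto
  ultimately show thesis using that[of v] by (simp add: reduced_def)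
qed

context
  fixes T assumes TS: "T \<subseteq> S"
begin

lemma word_over_subset: "w \<in> lists T \<Longrightarrow> w \<in> lists S"
  using TS lists_mono by blast

lemma reduced_appendD:
  assumes "reduced T (v @ w)"
  shows "reduced T v" "reduced T w"
proof -
  have l: "v \<in> lists T" "w \<in> lists T" using assms by (auto simp: reduced_def)
  show "reduced T v"
    unfolding reduced_def
  proof (intro conjI ballI impI)
    fix u assume "u \<in> lists T" "val u = val v"
    then show "length v \<le> length u"
      using reducedD[OF assms, of "u @ w"] l word_over_subset by simp
  qed (rule l)
  show "reduced T w"
    unfolding reduced_def
  proof (intro conjI ballI impI)
    fix u assume "u \<in> lists T" "val u = val w"
    then show "length w \<le> length u"
      using reducedD[OF assms, of "v @ u"] l word_over_subset by simp
  qed (rule l)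
qed

lemma reduced_same_value:
  assumes "reduced T w" "v \<in> lists T" "val v = val w" "length v = length w"
  shows "reduced T v"
  using assms by (simp add: reduced_def)

lemma not_reduced_double:
  assumes "s \<in> T"
  shows "\<not> reduced T (w @ [s, s])"
proof
  assume "reduced T (w @ [s, s])"
  then have "reduced T [s, s]" by (rule reduced_appendD)
  moreover have "val [s, s] = val []" using assms TS generator_squared in_carrier by auto
  ultimately show False using reducedD[of T "[s,s]" "[]"] by simp
qed

text \<open>
  The relator \<open>(st)\<^sup>k\<close> splits an alternating word of length \<open>2k\<close> into pieces of lengths \<open>k - 1\<close> and \<open>k + 1\<close>,
  so an alternating word of length \<open>k + 1\<close> has the same value as one of length \<open>k - 1\<close>.
\<close>

lemma reduced_alt_length:
  assumes "s \<in> T" "t \<in> T" "reduced T (alt s t n)"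
  shows "enat n \<le> m s t"
proof (rule ccontr)
  assume *: "\<not> enat n \<le> m s t"
  then obtain k where k: "m s t = enat k" "k < n" by (cases "m s t") auto
  have st: "s \<in> S" "t \<in> S" using assms TS by auto
  have "k \<noteq> 0"
    using m_self[of s] m_ge_2[of s t] k st by (cases "s = t") (auto simp: one_enat_def numeral_eq_enat zero_enat_def)
  then obtain j where j: "k = Suc j" by (cases k) auto
  have "n = (n - Suc k) + Suc k" using k by simp
  then have "\<exists>v. alt s t n = v @ alt s t (Suc k)" using alt_add[of s t "n - Suc k" "Suc k"] by metis
  then have r: "reduced T (alt s t (Suc k))" using assms(3) reduced_appendD(2) by metis
  define v where "v = (if even (Suc k) then alt s t j else alt t s j)"
  have v: "v \<in> lists T" "length v = j"
    unfolding v_def using assms(1,2) by (auto simp: alt_in_lists)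
  have "2 * k = j + Suc k" using j by simp
  then have "alt s t (2 * k) = v @ alt s t (Suc k)" unfolding v_def by (metis alt_add)
  then have "val (v @ alt s t (Suc k)) = \<one>"
    using relator_trivial[OF st k(1)] by (simp only: alt_even)
  moreover have "alt s t (Suc k) \<in> lists T" using assms by (intro alt_in_lists)
  ultimately have "inv (val v) = val (alt s t (Suc k))"
    using v word_over_subset by (intro inv_equality inv_comm[of "val v"]) (auto simp del: alt.simps)
  then have "val (rev v) = val (alt s t (Suc k))"
    using v word_over_subset word_value_rev_inv by simp
  then have "Suc k \<le> j"
    using reducedD[OF r, of "rev v"] v by (simp del: alt.simps)
  then show False using j by simp
qed

lemma cheb_B_nonneg:
  assumes "s \<in> T" "t \<in> T" "enat n \<le> m s t" "s \<noteq> t"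
  shows "0 \<le> cheb (- B s t) n"
proof (cases "m s t")
  case (enat k)
  have k: "2 \<le> k" using m_ge_2[of s t] enat assms TS by (auto simp: numeral_eq_enat)
  define \<theta> where "\<theta> = pi / real k"
  have "0 < \<theta>" "\<theta> < pi" "real n * \<theta> \<le> pi" "0 \<le> real n * \<theta>"
    using k assms(3) enat by (auto simp: \<theta>_def field_simps)
  then have "0 < sin \<theta>" "0 \<le> sin (real n * \<theta>)" using sin_gt_zero sin_ge_zero by auto
  moreover have "- B s t = cos \<theta>" by (simp add: enat cos_matrix_def \<theta>_def)
  ultimately show ?thesis using cheb_sin[of \<theta> n] by (metis zero_le_mult_iff not_less)
next
  case infinity
  then show ?thesis by (simp add: cos_matrix_def cheb_one)
qed

text \<open>
  Tits' lemma: if \<open>w s\<close> is longer than \<open>w\<close>, the root \<open>w \<alpha>\<^sub>s\<close> is positive. Positivity is tested on the linear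
  form that takes the value \<open>1\<close> at all simple roots, which suffices for faithfulness.

  Let \<open>t\<close> be the last letter of \<open>w\<close>, and write \<open>w = v x\<close> with lengths adding up, where \<open>x\<close> is an
  alternating word in \<open>s\<close> and \<open>t\<close> ending with \<open>t\<close> that is as long as possible. Then both \<open>v s\<close> and \<open>v t\<close> are
  longer than \<open>v\<close>, so \<open>v \<alpha>\<^sub>s\<close> and \<open>v \<alpha>\<^sub>t\<close> are positive by induction. As \<open>x s\<close> is still reduced, \<open>x\<close> is shorter
  than the label of \<open>s\<close> and \<open>t\<close>, hence \<open>x \<alpha>\<^sub>s\<close> is a nonnegative combination of \<open>\<alpha>\<^sub>s\<close> and \<open>\<alpha>\<^sub>t\<close>.
\<close>

lemma ascent_positive:
  assumes "reduced T w" "reduced T (w @ [s])" "s \<in> T"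
  shows "0 \<le> act B w (\<lambda>_. 1) s"
  using assms
proof (induction "length w" arbitrary: w s rule: less_induct)
  case less
  show ?case
  proof (cases w rule: rev_cases)
    case (snoc w1 t)
    have tT: "t \<in> T" and w1: "w1 \<in> lists T" and w: "w \<in> lists T"
      using less.prems(1) snoc by (auto simp: reduced_def)
    have st: "s \<noteq> t"
      using less.prems not_reduced_double[of s w1] snoc by auto
    define P where "P n \<longleftrightarrow> (\<exists>v \<in> lists T. length v + n = length w \<and> val (v @ alt s t n) = val w)" for n
    have "P 1" unfolding P_def using snoc w1 by (intro bexI[of _ w1]) auto
    moreover have "\<forall>n. P n \<longrightarrow> n \<le> length w" unfolding P_def by auto
    ultimately obtain n where n: "P n" "\<forall>j. P j \<longrightarrow> j \<le> n"
      using Nat.ex_has_greatest_nat[of P 1 "length w"] by auto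
    have "1 \<le> n" using n \<open>P 1\<close> by blast
    obtain v where v: "v \<in> lists T" "length v + n = length w" "val (v @ alt s t n) = val w"
      using n(1) unfolding P_def by blast
    have alt: "alt s t n \<in> lists T" using less.prems(3) tT by (intro alt_in_lists)
    have red: "reduced T (v @ alt s t n)"
      by (rule reduced_same_value[OF less.prems(1)]) (use v alt in auto)
    have S: "v \<in> lists S" "alt s t n \<in> lists S" "w \<in> lists S" "[s] \<in> lists S"
      using v(1) alt w less.prems(3) word_over_subset by auto
    have "val ((v @ alt s t n) @ [s]) = val (w @ [s])"
      using S v(3) word_value_append[of "v @ alt s t n" "[s]"] word_value_append[of w "[s]"]
      by (metis append_in_lists_conv)
    then have "reduced T ((v @ alt s t n) @ [s])"
      by (intro reduced_same_value[OF less.prems(2)]) (use v(1,2) alt less.prems(3) in auto)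
    then have "reduced T (alt t s (Suc n))"
      using reduced_appendD(2)[of v "alt t s (Suc n)"] by simp
    then have "enat (Suc n) \<le> m t s"
      using reduced_alt_length tT less.prems(3) by blast
    moreover have "m s t = m t s" using tT less.prems(3) TS by (intro m_sym) auto
    ultimately have len: "enat (Suc n) \<le> m s t" by simp
    obtain k where k: "n = Suc k" using \<open>1 \<le> n\<close> by (cases n) auto
    \<comment> \<open>The first letter of the alternating word is \<open>x\<close>; both neighbours \<open>v x\<close> and \<open>v y\<close> of \<open>v\<close> are
      longer than \<open>v\<close>.\<close>
    define x where "x = (if even k then t else s)"
    define y where "y = (if even k then s else t)"
    have xy: "{x, y} = {s, t}" "x \<in> T" "y \<in> T"
      unfolding x_def y_def using tT less.prems(3) by auto
    have alt_x: "alt s t n = x # alt s t k" unfolding k x_def by (rule alt_Cons)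
    have redv: "reduced T v" using red by (rule reduced_appendD)
    have redx: "reduced T (v @ [x])"
      using reduced_appendD(1)[of "v @ [x]" "alt s t k"] red alt_x by simp
    have redy: "reduced T (v @ [y])"
    proof (rule ccontr)
      assume "\<not> reduced T (v @ [y])"
      then obtain u where u: "u \<in> lists T" "val u = val (v @ [y])" "length u < Suc (length v)"
        using v(1) xy by (auto simp: reduced_def not_le)
      have vy: "v @ [y] \<in> lists S" using v(1) xy word_over_subset TS by auto
      have yy: "y \<in> carrier W" "y \<otimes> y = \<one>" using xy TS in_carrier generator_squared by auto
      have uy: "val (u @ [y]) = val v"
      proof -
        have "val (u @ [y]) = val (v @ [y]) \<otimes> y"
          using u(1,2) xy TS word_over_subset[OF u(1)] yy by (simp add: subset_iff)
        also have "\<dots> = val v \<otimes> (y \<otimes> y)"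
          using S(1) vy yy(1) by (simp add: m_assoc)
        finally show ?thesis using yy S(1) by simp
      qed
      \<comment> \<open>The parity of the length rules out that \<open>v y\<close> is as long as \<open>v\<close>, so it is shorter by one.\<close>
      have "length v \<le> Suc (length u)"
        using reducedD[OF redv, of "u @ [y]"] u uy xy by simp
      moreover have "even (length u) \<longleftrightarrow> even (length (v @ [y]))"
        using same_value(2)[of u "v @ [y]"] u(2) vy word_over_subset[OF u(1)] by blast
      ultimately have lu: "length v = Suc (length u)"
        using u(3) by (cases "length u = length v") auto
      have "y # alt s t n = alt s t (Suc n)"
        using alt_Cons[of s t n] by (simp add: y_def k del: alt.simps)
      then have "val (u @ alt s t (Suc n)) = val ((u @ [y]) @ alt s t n)" by simp
      also have "\<dots> = val (v @ alt s t n)"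
        using uy S(1,2) word_over_subset[OF u(1)] vy by (subst (1 2) word_value_append) auto
      also note v(3)
      finally have "P (Suc n)"
        unfolding P_def using u lu v by (intro bexI[of _ u]) (auto simp del: alt.simps)
      then show False using n(2) by (meson Suc_n_not_le_n)
    qed
    define g where "g = act B v (\<lambda>_. 1)"
    have "length v < length w" using v \<open>1 \<le> n\<close> by simp
    then have "0 \<le> g x" "0 \<le> g y"
      unfolding g_def using less.hyps[of v] redv redx redy xy by auto
    then have g: "0 \<le> g s" "0 \<le> g t" using xy(1) by (auto simp: x_def y_def split: if_splits)
    have "act B w (\<lambda>_. 1) s = act B (v @ alt s t n) (\<lambda>_. 1) s"
      using same_value(1)[of w "v @ alt s t n"] S v(3) by simp
    also have "\<dots> = act B (alt s t n) g s" by (simp add: g_def)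
    also have "\<dots> = cheb (- B s t) (Suc n) * (if even n then g s else g t) +
        cheb (- B s t) n * (if even n then g t else g s)"
      using tT less.prems(3) TS B_self B_sym[of t s] by (intro act_alt) (simp_all add: subset_iff)
    also have "\<dots> \<ge> 0"
    proof -
      have "enat n \<le> m s t" using len by (meson enat_ord_simps(1) le_SucI order_refl order_trans)
      then have "0 \<le> cheb (- B s t) (Suc n)" "0 \<le> cheb (- B s t) n"
        using cheb_B_nonneg[of s t] tT less.prems(3) st len by auto
      then show ?thesis using g by (simp del: cheb.simps)
    qed
    finally show ?thesis .
  qed simp
qed

text \<open>
  A nontrivial element of \<open>W\<^sub>T\<close> has a reduced word over \<open>T\<close>, ending with some \<open>s\<close>. Without its last letter it
  maps \<open>\<alpha>\<^sub>s\<close> to a positive root, so it maps \<open>\<alpha>\<^sub>s\<close> itself to a negative one. Only the labels within \<open>T\<close> enter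
  the condition on the right.
\<close>

lemma faithful:
  assumes "w \<in> lists T"
  shows "val w = \<one> \<longleftrightarrow> (\<forall>t\<in>T. act B w (\<lambda>_. 1) t = 1)"
proof
  assume "val w = \<one>"
  then show "\<forall>t\<in>T. act B w (\<lambda>_. 1) t = 1" using trivial_word(1)[of w] assms word_over_subset by simp
next
  assume fixed: "\<forall>t\<in>T. act B w (\<lambda>_. 1) t = 1"
  obtain v where v: "reduced T v" "val v = val w" using reduced_exists[OF assms] .
  show "val w = \<one>"
  proof (cases v rule: rev_cases)
    case Nil
    then show ?thesis using v by simp
  next
    case (snoc u s)
    have s: "s \<in> T" "s \<in> S" using reduced_lists[OF v(1)] snoc TS by auto
    have "0 \<le> act B u (\<lambda>_. 1) s"
      using ascent_positive[of u s] v(1) snoc reduced_appendD(1)[of u "[s]"] s by auto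
    then have "act B v (\<lambda>_. 1) s \<le> 0" using snoc s by (simp add: reflect_self B_self)
    moreover have "act B v (\<lambda>_. 1) = act B w (\<lambda>_. 1)"
      using v reduced_lists word_over_subset assms by (intro same_value(1)) auto
    ultimately show ?thesis using fixed s by fastforce
  qed
qed

end

end

section \<open>Spherical subsets containing an edge with a large label\<close>

context coxeter
begin

lemma same_value_iff:
  assumes "v \<in> lists S" "w \<in> lists S"
  shows "val v = val w \<longleftrightarrow> val (v @ rev w) = \<one>"
proof
  assume "val v = val w"
  then show "val (v @ rev w) = \<one>" using assms word_value_rev_inv[of w] by simp
next
  assume "val (v @ rev w) = \<one>"
  then have "val v \<otimes> inv (val w) = \<one>" using assms word_value_rev_inv[of w] by simp
  then have "inv (inv (val w)) = val v" using assms by (intro inv_equality) auto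
  then show "val v = val w" using assms by simp
qed

lemma spherical_iff: "T \<subseteq> S \<Longrightarrow> spherical W T \<longleftrightarrow> finite (val ` lists T)"
  by (simp add: spherical_def special_carrier)

lemma spherical_subset: "U \<subseteq> T \<Longrightarrow> T \<subseteq> S \<Longrightarrow> spherical W T \<Longrightarrow> spherical W U"
  using spherical_iff[of T] spherical_iff[of U] lists_mono[of U T]
  by (meson finite_subset image_mono order_trans)

lemma reduced_pair_alt:
  assumes "s \<in> S" "t \<in> S" "reduced {s, t} w"
  shows "w = alt s t (length w) \<or> w = alt t s (length w)"
  using assms(3)
proof (induction w rule: rev_induct)
  case (snoc x u)
  have ST: "{s, t} \<subseteq> S" using assms by simp
  have x: "x = s \<or> x = t" using reduced_lists[OF snoc.prems] by auto
  have u: "u = alt s t (length u) \<or> u = alt t s (length u)"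
    using snoc.IH reduced_appendD(1)[OF ST snoc.prems] by blast
  have ends: "x \<noteq> b" if ab: "u = alt a b (length u)" "u \<noteq> []" "{a, b} = {s, t}" for a b
  proof
    assume "x = b"
    obtain n where "length u = Suc n" using ab(2) by (cases u) auto
    then have "u @ [x] = alt b a n @ [b, b]" using ab(1) \<open>x = b\<close> by (metis alt.simps(2) append.assoc append_Cons append_Nil)
    then show False using not_reduced_double[OF ST, of b] snoc.prems ab(3) by auto
  qed
  show ?case
  proof (cases "u = []")
    case True
    then show ?thesis using x by auto
  next
    case False
    then show ?thesis using u ends[of s t] ends[of t s] x by (auto simp: insert_commute)
  qed
qed simp

text \<open>
  Reduced words in two letters alternate and have at most the length of the label.
\<close>

lemma pair_spherical:
  assumes "s \<in> S" "t \<in> S" "m s t \<noteq> \<infinity>"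
  shows "spherical W {s, t}"
proof -
  have ST: "{s, t} \<subseteq> S" using assms by simp
  obtain k where k: "m s t = enat k" using assms(3) by auto
  have k': "m t s = enat k" using k m_sym[OF assms(2,1)] by simp
  have "val ` lists {s, t} \<subseteq> val ` ((\<lambda>n. alt s t n) ` {..k} \<union> (\<lambda>n. alt t s n) ` {..k})"
  proof
    fix x assume "x \<in> val ` lists {s, t}"
    then obtain w where w: "reduced {s, t} w" "val w = x"
      using reduced_exists by (metis imageE)
    have "w \<in> (\<lambda>n. alt s t n) ` {..k} \<union> (\<lambda>n. alt t s n) ` {..k}"
      using reduced_pair_alt[OF assms(1,2) w(1)]
    proof
      assume "w = alt s t (length w)"
      moreover from this have "length w \<le> k"
        using reduced_alt_length[OF ST, of s t "length w"] w(1) k by simp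
      ultimately show ?thesis by blast
    next
      assume "w = alt t s (length w)"
      moreover from this have "length w \<le> k"
        using reduced_alt_length[OF ST, of t s "length w"] w(1) k' by simp
      ultimately show ?thesis by blast
    qed
    then show "x \<in> val ` ((\<lambda>n. alt s t n) ` {..k} \<union> (\<lambda>n. alt t s n) ` {..k})"
      using w(2) by blast
  qed
  then show ?thesis unfolding spherical_iff[OF ST] by (rule finite_subset) simp
qed

lemma commuting_union_spherical:
  assumes "A \<subseteq> S" "R \<subseteq> S" "\<forall>a\<in>A. \<forall>r\<in>R. a \<otimes> r = r \<otimes> a" "spherical W A" "spherical W R"
  shows "spherical W (A \<union> R)"
proof -
  have comm: "val v \<otimes> r = r \<otimes> val v" if "v \<in> lists A" "r \<in> R" for v r
    using that(1)
  proof (induction v)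
    case Nil
    then show ?case using that assms(2) in_carrier by auto
  next
    case (Cons a v)
    have c: "a \<in> carrier W" "r \<in> carrier W" "val v \<in> carrier W"
      using Cons that assms(1,2) in_carrier lists_mono[of A S] by auto
    have "val (a # v) \<otimes> r = a \<otimes> (val v \<otimes> r)" using c by (simp add: m_assoc)
    also have "\<dots> = (a \<otimes> r) \<otimes> val v" using Cons c by (simp add: m_assoc)
    also have "a \<otimes> r = r \<otimes> a" using assms(3) Cons that by auto
    finally show ?case using c by (simp add: m_assoc)
  qed
  have prod: "\<exists>a\<in>lists A. \<exists>r\<in>lists R. val w = val a \<otimes> val r" if "w \<in> lists (A \<union> R)" for w
    using that
  proof (induction w)
    case Nil
    have "val [] = val [] \<otimes> val []" by simp
    moreover have "[] \<in> lists A" "[] \<in> lists R" by auto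
    ultimately show ?case by blast
  next
    case (Cons s w)
    then obtain a r where ar: "a \<in> lists A" "r \<in> lists R" "val w = val a \<otimes> val r" by auto
    have "s \<in> S" using Cons.hyps assms(1,2) by auto
    then have c: "val a \<in> carrier W" "val r \<in> carrier W" "s \<in> carrier W"
      using ar assms(1,2) lists_mono[of A S] lists_mono[of R S] in_carrier by auto
    consider "s \<in> A" | "s \<in> R" using Cons.hyps by auto
    then show ?case
    proof cases
      case 1
      have "val (s # w) = val (s # a) \<otimes> val r" using ar c by (simp add: m_assoc)
      moreover have "s # a \<in> lists A" using 1 ar by simp
      ultimately show ?thesis using ar(2) by blast
    next
      case 2
      have "val (s # w) = (val a \<otimes> s) \<otimes> val r" using ar c comm[OF ar(1) 2] by (simp add: m_assoc)
      then have "val (s # w) = val a \<otimes> val (s # r)" using c by (simp add: m_assoc)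
      moreover have "s # r \<in> lists R" using 2 ar by simp
      ultimately show ?thesis using ar(1) by blast
    qed
  qed
  have "val ` lists (A \<union> R) \<subseteq> (\<lambda>(x, y). x \<otimes> y) ` (val ` lists A \<times> val ` lists R)"
  proof
    fix x assume "x \<in> val ` lists (A \<union> R)"
    then obtain a r where "a \<in> lists A" "r \<in> lists R" "x = val a \<otimes> val r"
      using prod by blast
    then show "x \<in> (\<lambda>(x, y). x \<otimes> y) ` (val ` lists A \<times> val ` lists R)"
      by (intro image_eqI[of _ _ "(val a, val r)"]) auto
  qed
  moreover have "finite ((\<lambda>(x, y). x \<otimes> y) ` (val ` lists A \<times> val ` lists R))"
    using assms spherical_iff by simp
  ultimately have "finite (val ` lists (A \<union> R))" by (rule finite_subset)
  then show ?thesis using assms(1,2) spherical_iff[of "A \<union> R"] by blast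
qed

text \<open>
  If \<open>W\<^sub>T\<close> is finite, the orbit \<open>F\<close> of the form that takes the value \<open>1\<close> at all simple roots is finite, and
  \<open>Q(x,y) = \<Sum> f(x) f(y)\<close>, summed over \<open>f\<close> in \<open>F\<close>, is an invariant inner product. The reflection \<open>s\<close> is
  orthogonal for \<open>Q\<close> as well as for \<open>B\<close>. A reflection is orthogonal for only one functional \<open>Q(-, \<alpha>\<^sub>s)\<close> up to
  a factor, so this functional is proportional to \<open>B(-, \<alpha>\<^sub>s)\<close>.
\<close>

lemma spherical_invariant_form:
  assumes "T \<subseteq> S" "spherical W T"
  obtains F where "finite F" "(\<lambda>_. 1) \<in> F"
    and "\<And>s u. s \<in> T \<Longrightarrow> (\<Sum>f\<in>F. f u * f s) = B s u * (\<Sum>f\<in>F. f s * f s)"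
proof
  define F where "F = (\<lambda>w. act B w (\<lambda>_. 1)) ` lists T"
  define h where "h x = act B (SOME w. w \<in> lists T \<and> val w = x) (\<lambda>_. 1)" for x
  have TL: "w \<in> lists T \<Longrightarrow> w \<in> lists S" for w using word_over_subset[OF assms(1)] .
  have "F \<subseteq> h ` (val ` lists T)"
  proof
    fix f assume "f \<in> F"
    then obtain w where w: "w \<in> lists T" "f = act B w (\<lambda>_. 1)" by (auto simp: F_def)
    have "(SOME v. v \<in> lists T \<and> val v = val w) \<in> lists T \<and> val (SOME v. v \<in> lists T \<and> val v = val w) = val w"
      by (rule someI[of _ w]) (use w in simp)
    then have "f = h (val w)" unfolding h_def w(2) using same_value(1) TL w(1) by metis
    then show "f \<in> h ` (val ` lists T)" using w(1) by blast
  qed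
  then show "finite F" using assms spherical_iff finite_subset by (metis finite_imageI)
  have "act B [] (\<lambda>_. 1) \<in> F" unfolding F_def by (rule imageI) simp
  then show "(\<lambda>_. 1) \<in> F" by simp
  fix s u assume s: "s \<in> T"
  then have Bs: "B s s = 1" using B_self assms(1) by auto
  have closed: "reflect B s f \<in> F" if "f \<in> F" for f
  proof -
    obtain w where "w \<in> lists T" "f = act B w (\<lambda>_. 1)" using \<open>f \<in> F\<close> by (auto simp: F_def)
    then have "reflect B s f = act B (w @ [s]) (\<lambda>_. 1)" "w @ [s] \<in> lists T" using s by auto
    then show ?thesis unfolding F_def by blast
  qed
  have "(\<Sum>f\<in>F. f u * f s) = (\<Sum>f\<in>F. reflect B s f u * reflect B s f s)"
    by (rule sum.reindex_bij_witness[of _ "reflect B s" "reflect B s"])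
      (auto simp: closed reflect_reflect Bs)
  also have "\<dots> = (\<Sum>f\<in>F. 2 * B s u * (f s * f s) - f u * f s)"
    by (simp add: reflect_self Bs) (simp add: reflect_def algebra_simps)
  also have "\<dots> = 2 * B s u * (\<Sum>f\<in>F. f s * f s) - (\<Sum>f\<in>F. f u * f s)"
    by (simp add: sum_subtractf sum_distrib_left)
  finally show "(\<Sum>f\<in>F. f u * f s) = B s u * (\<Sum>f\<in>F. f s * f s)" by simp
qed

text \<open>
  The numbers \<open>N s = Q(\<alpha>\<^sub>s, \<alpha>\<^sub>s)\<close> agree along edges, so on the span of \<open>\<alpha>\<^sub>p\<close>, \<open>\<alpha>\<^sub>q\<close>, \<open>\<alpha>\<^sub>t\<close> the inner product \<open>Q\<close> is a
  positive multiple of \<open>B\<close>.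
\<close>

lemma large_label_not_spherical:
  assumes "T \<subseteq> S" "p \<in> T" "q \<in> T" "t \<in> T" "p \<noteq> q" "t \<noteq> p" "t \<noteq> q"
    and pq: "6 \<le> m p q" and qt: "m q t \<noteq> 2"
  shows "\<not> spherical W T"
proof
  assume "spherical W T"
  then obtain F where F: "finite F" "(\<lambda>_. 1) \<in> F"
    and Q: "\<And>s u. s \<in> T \<Longrightarrow> (\<Sum>f\<in>F. f u * f s) = B s u * (\<Sum>f\<in>F. f s * f s)"
    using spherical_invariant_form[OF assms(1)] by blast
  define N where "N s = (\<Sum>f\<in>F. f s * f s)" for s
  have in_S: "p \<in> S" "q \<in> S" "t \<in> S" using assms by auto
  have pos: "0 < N s" for s
  proof -
    have "1 * 1 \<le> N s" unfolding N_def
      using member_le_sum[of "\<lambda>_. 1" F "\<lambda>f. f s * f s"] F by simp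
    then show ?thesis by simp
  qed
  have N_eq: "N u = N v" if "u \<in> T" "v \<in> T" "B u v < 0" for u v
  proof -
    have "B u v * N u = B v u * N v"
      using Q[of u v] Q[of v u] that(1,2) by (simp add: N_def mult.commute)
    moreover have "B u v = B v u" using that assms(1) by (intro B_sym) auto
    ultimately show ?thesis using that(3) by simp
  qed
  have "B p q \<le> - cos (pi / real 6)"
    using pq by (intro B_le) (auto simp: numeral_eq_enat)
  then have Bpq: "B p q \<le> - (sqrt 3 / 2)" by (simp add: cos_30)
  have "enat 3 \<le> m q t"
    using m_ge_2[of q t] qt in_S assms(7) by (cases "m q t") (auto simp: numeral_eq_enat)
  then have "B q t \<le> - cos (pi / real 3)" by (intro B_le) auto
  then have Bqt: "B q t \<le> - (1 / 2)" by (simp add: cos_60)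
  have Bpt: "B p t \<le> 0" using B_nonpos in_S assms(6) by blast
  have "0 < sqrt (3::real)" by simp
  then have "B p q < 0" "B q t < 0" using Bpq Bqt by linarith+
  then have "N p = N q" "N q = N t" using N_eq[OF assms(2,3)] N_eq[OF assms(3,4)] by auto
  then have N: "N p = N q" "N t = N q" by auto
  define r where "r = sqrt (3::real)"
  have r: "r * r = 3" "0 < r" unfolding r_def by auto
  \<comment> \<open>The vector \<open>\<surd>3 \<alpha>\<^sub>p + 2 \<alpha>\<^sub>q + \<alpha>\<^sub>t\<close> spans the radical of the form of the affine triangle group with
    labels \<open>6\<close>, \<open>3\<close>, \<open>2\<close>; larger labels only decrease the form on it.\<close>
  have "0 < (\<Sum>f\<in>F. (r * f p + 2 * f q + f t)\<^sup>2)"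
  proof -
    have "(r * 1 + 2 * 1 + 1)\<^sup>2 \<le> (\<Sum>f\<in>F. (r * f p + 2 * f q + f t)\<^sup>2)"
      using member_le_sum[of "\<lambda>_. 1" F "\<lambda>f. (r * f p + 2 * f q + f t)\<^sup>2"] F by simp
    moreover have "0 < (r * 1 + 2 * 1 + 1)\<^sup>2" using r by (intro zero_less_power) simp
    ultimately show ?thesis by linarith
  qed
  also have "(\<Sum>f\<in>F. (r * f p + 2 * f q + f t)\<^sup>2) =
    (\<Sum>f\<in>F. 3 * (f p * f p) + 4 * (f q * f q) + f t * f t + 4 * r * (f q * f p)
      + 4 * (f t * f q) + 2 * r * (f t * f p))"
  proof (rule sum.cong)
    fix f 
    have "(r * f p + 2 * f q + f t)\<^sup>2 = (r * r) * (f p * f p) + 4 * (f q * f q) + f t * f t + 4 * r * (f q * f p)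
      + 4 * (f t * f q) + 2 * r * (f t * f p)"
      by (simp add: power2_eq_square algebra_simps)
    then show "(r * f p + 2 * f q + f t)\<^sup>2 = 3 * (f p * f p) + 4 * (f q * f q) + f t * f t + 4 * r * (f q * f p)
      + 4 * (f t * f q) + 2 * r * (f t * f p)" by (simp only: r(1))
  qed simp
  also have "\<dots> = 3 * N p + 4 * N q + N t + 4 * r * (B p q * N p) + 4 * (B q t * N q) + 2 * r * (B p t * N p)"
    using Q[of p q] Q[of q t] Q[of p t] assms(2,3)
    by (simp add: sum.distrib N_def flip: sum_distrib_left)
  also have "\<dots> = N q * (8 + 4 * (r * B p q) + 4 * B q t + 2 * (r * B p t))"
    by (simp add: N algebra_simps)
  finally have "0 < 8 + 4 * (r * B p q) + 4 * B q t + 2 * (r * B p t)"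
    using pos[of q] by (simp add: zero_less_mult_iff)
  moreover have "r * B p q \<le> r * (- (r / 2))"
    using Bpq r unfolding r_def[symmetric] by (intro mult_left_mono) auto
  moreover have "r * B p t \<le> 0" using r Bpt by (simp add: mult_le_0_iff)
  ultimately show False using Bqt r(1) by simp
qed

lemma spherical_large_label_iff:
  assumes "T \<subseteq> S" "p \<in> T" "q \<in> T" "p \<noteq> q" "6 \<le> m p q" "m p q \<noteq> \<infinity>"
  shows "spherical W T \<longleftrightarrow>
    (\<forall>t \<in> T - {p, q}. m p t = 2 \<and> m q t = 2) \<and> spherical W (T - {p, q})"
proof
  assume sph: "spherical W T"
  have "m q p = m p q" using assms by (intro m_sym) auto
  then have "m q t = 2" "m p t = 2" if "t \<in> T - {p, q}" for t
    using large_label_not_spherical[of T p q t] large_label_not_spherical[of T q p t] sph assms that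
    by auto
  then show "(\<forall>t \<in> T - {p, q}. m p t = 2 \<and> m q t = 2) \<and> spherical W (T - {p, q})"
    using spherical_subset[OF _ assms(1) sph] by auto
next
  assume R: "(\<forall>t \<in> T - {p, q}. m p t = 2 \<and> m q t = 2) \<and> spherical W (T - {p, q})"
  have "a \<otimes> r = r \<otimes> a" if "a \<in> {p, q}" "r \<in> T - {p, q}" for a r
    using that R assms(1-3) commute_iff[of a r] by auto
  then have "\<forall>a\<in>{p, q}. \<forall>r\<in>T - {p, q}. a \<otimes> r = r \<otimes> a" by blast
  moreover have "spherical W {p, q}" using assms by (intro pair_spherical) auto
  ultimately have "spherical W ({p, q} \<union> (T - {p, q}))"
    using R assms by (intro commuting_union_spherical) auto
  moreover have "{p, q} \<union> (T - {p, q}) = T" using assms by auto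
  ultimately show "spherical W T" by simp
qed

end

section \<open>Special subgroups with equal matrices\<close>

lemma act_map:
  assumes "w \<in> lists T" "\<And>s t. s \<in> T \<Longrightarrow> t \<in> T \<Longrightarrow> B s t = B' (\<iota> s) (\<iota> t)"
    and "\<And>t. t \<in> T \<Longrightarrow> f t = f' (\<iota> t)" and "u \<in> T"
  shows "act B w f u = act B' (map \<iota> w) f' (\<iota> u)"
  using assms(1,3)
proof (induction w arbitrary: f f')
  case Nil
  then show ?case using assms(4) by simp
next
  case (Cons s w)
  have s: "s \<in> T" using Cons.hyps by simp
  have "act B w (reflect B s f) u = act B' (map \<iota> w) (reflect B' (\<iota> s) f') (\<iota> u)"
    using Cons.prems assms(2)[OF s] s by (intro Cons.IH) (auto simp: reflect_def)
  then show ?case by simp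
qed

text \<open>
  By faithfulness, whether two words over \<open>T\<close> have the same value is decided by the restriction of the
  matrix to \<open>T\<close>. So sending the value of a word to the value of its image under \<open>\<iota>\<close> is well defined
  and injective.
\<close>

lemma special_subgroup_iso:
  fixes W :: "('a, 'c) monoid_scheme" and W' :: "('b, 'd) monoid_scheme"
  assumes "coxeter W S m" "coxeter W' S' m'" "T \<subseteq> S" "\<iota> ` T \<subseteq> S'"
    and m: "\<And>s t. s \<in> T \<Longrightarrow> t \<in> T \<Longrightarrow> m s t = m' (\<iota> s) (\<iota> t)"
  obtains \<phi> where "\<phi> \<in> iso (subgroup_generated W T) (subgroup_generated W' (\<iota> ` T))"
    and "\<And>t. t \<in> T \<Longrightarrow> \<phi> t = \<iota> t"
proof -
  interpret C: coxeter W S m by fact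
  interpret C': coxeter W' S' m' by fact
  have lists_S: "w \<in> lists T \<Longrightarrow> w \<in> lists S" "w \<in> lists T \<Longrightarrow> map \<iota> w \<in> lists (\<iota> ` T)"
    "w \<in> lists T \<Longrightarrow> map \<iota> w \<in> lists S'" for w
    using assms(3,4) by (auto simp: in_lists_conv_set)
  have triv: "C.val w = \<one>\<^bsub>W\<^esub> \<longleftrightarrow> C'.val (map \<iota> w) = \<one>\<^bsub>W'\<^esub>" if w: "w \<in> lists T" for w
  proof -
    have "act C.B w (\<lambda>_. 1) t = act C'.B (map \<iota> w) (\<lambda>_. 1) (\<iota> t)" if "t \<in> T" for t
      using w that m by (intro act_map[where T = T]) (auto simp: cos_matrix_def)
    then show ?thesis
      using C.faithful[OF assms(3) w] C'.faithful[OF assms(4) lists_S(2)[OF w]] by auto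
  qed
  have eq: "C.val v = C.val w \<longleftrightarrow> C'.val (map \<iota> v) = C'.val (map \<iota> w)"
    if vw: "v \<in> lists T" "w \<in> lists T" for v w
  proof -
    have "C.val v = C.val w \<longleftrightarrow> C.val (v @ rev w) = \<one>\<^bsub>W\<^esub>"
      using vw lists_S(1) by (intro C.same_value_iff)
    also have "\<dots> \<longleftrightarrow> C'.val (map \<iota> (v @ rev w)) = \<one>\<^bsub>W'\<^esub>"
      using vw by (intro triv) simp
    also have "\<dots> \<longleftrightarrow> C'.val (map \<iota> v) = C'.val (map \<iota> w)"
      using vw lists_S(3) C'.same_value_iff[of "map \<iota> v" "map \<iota> w"] by (simp add: rev_map)
    finally show ?thesis .
  qed
  define \<phi> where "\<phi> x = C'.val (map \<iota> (SOME w. w \<in> lists T \<and> C.val w = x))" for x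
  have \<phi>: "\<phi> (C.val w) = C'.val (map \<iota> w)" if "w \<in> lists T" for w
  proof -
    have "(SOME v. v \<in> lists T \<and> C.val v = C.val w) \<in> lists T \<and>
      C.val (SOME v. v \<in> lists T \<and> C.val v = C.val w) = C.val w"
      by (rule someI[of _ w]) (use that in simp)
    then show ?thesis unfolding \<phi>_def using eq that by blast
  qed
  have carrier: "carrier (subgroup_generated W T) = C.val ` lists T"
    using C.special_carrier[OF assms(3)] .
  have carrier': "carrier (subgroup_generated W' (\<iota> ` T)) = (\<lambda>w. C'.val (map \<iota> w)) ` lists T"
    unfolding C'.special_carrier[OF assms(4)] lists_image by (simp add: image_image)
  have "\<phi> \<in> iso (subgroup_generated W T) (subgroup_generated W' (\<iota> ` T))"
  proof (rule isoI)
    show "\<phi> \<in> hom (subgroup_generated W T) (subgroup_generated W' (\<iota> ` T))"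
    proof (rule homI)
      show "\<phi> x \<in> carrier (subgroup_generated W' (\<iota> ` T))"
        if "x \<in> carrier (subgroup_generated W T)" for x
        using that \<phi> unfolding carrier carrier' by auto
      fix x y assume "x \<in> carrier (subgroup_generated W T)" "y \<in> carrier (subgroup_generated W T)"
      then obtain v w where vw: "v \<in> lists T" "w \<in> lists T" "x = C.val v" "y = C.val w"
        unfolding carrier by auto
      have "\<phi> (C.val (v @ w)) = C'.val (map \<iota> (v @ w))" using vw by (intro \<phi>) simp
      then show "\<phi> (x \<otimes>\<^bsub>subgroup_generated W T\<^esub> y) =
        \<phi> x \<otimes>\<^bsub>subgroup_generated W' (\<iota> ` T)\<^esub> \<phi> y"
        using vw lists_S \<phi> by (simp add: subgroup_generated_def)
    qed
    show "bij_betw \<phi> (carrier (subgroup_generated W T)) (carrier (subgroup_generated W' (\<iota> ` T)))"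
      unfolding carrier carrier' bij_betw_def
      using \<phi> eq by (auto simp: inj_on_def image_image cong: image_cong_simp)
  qed
  moreover have "\<phi> t = \<iota> t" if "t \<in> T" for t
    using \<phi>[of "[t]"] that assms(3,4) C.in_carrier C'.in_carrier by (auto simp: subset_iff)
  ultimately show thesis using that by blast
qed

lemma spherical_iso:
  assumes "\<phi> \<in> iso (subgroup_generated W T) (subgroup_generated W' T')"
  shows "spherical W T \<longleftrightarrow> spherical W' T'"
  using assms bij_betw_finite unfolding iso_def spherical_def by blast

section \<open>Angles between the walls of a chamber\<close>

lemma scalar_prod_self_nonneg: "0 \<le> (v :: real vec) \<bullet> v"
  by (simp add: scalar_prod_def sum_nonneg)

text \<open>
  The part of an affine structure that determines the angles between the walls: there are no
  hyperplanes of reflections inside the polytope, because its translates do not overlap.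
\<close>

locale chamber_action =
  fixes G :: "('a, 'c) monoid_scheme" (structure) and T :: "'a set"
    and d :: nat and u :: "'a \<Rightarrow> real vec" and c :: "'a \<Rightarrow> real" and \<rho> :: "'a \<Rightarrow> real vec \<Rightarrow> real vec"
  assumes group: "group G" and T_carrier: "T \<subseteq> carrier G"
    and polytope: "compact_polytope d T u c"
    and hom: "\<rho> \<in> hom G (BijGroup (carrier_vec d))"
    and reflection: "\<And>t. t \<in> T \<Longrightarrow> \<rho> t = hyperplane_reflection d (u t) (c t)"
    and disjoint: "\<And>g. g \<in> carrier G \<Longrightarrow> g \<noteq> \<one> \<Longrightarrow>
      \<rho> g ` polytope_interior d T u c \<inter> polytope_interior d T u c = {}"
begin

sublocale group G by (rule group)

text \<open>
  Heights above the walls transform by \<^const>\<open>reflect\<close> for the Gram matrix of the normals. Outside \<open>T\<close> both are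
  set to \<open>0\<close> to turn this into an equation between functions on the whole type.
\<close>

definition gram :: "'a \<Rightarrow> 'a \<Rightarrow> real"
  where "gram s t = (if t \<in> T then u s \<bullet> u t else 0)"

definition height :: "real vec \<Rightarrow> 'a \<Rightarrow> real"
  where "height y t = (if t \<in> T then u t \<bullet> y - c t else 0)"

abbreviation interior :: "real vec set"
  where "interior \<equiv> polytope_interior d T u c"

lemma u_carrier [simp]: "t \<in> T \<Longrightarrow> u t \<in> carrier_vec d"
  using polytope by (simp add: compact_polytope_def)

lemma u_dim [simp]: "t \<in> T \<Longrightarrow> dim_vec (u t) = d"
  using u_carrier by (rule carrier_vecD)

lemma u_unit: "t \<in> T \<Longrightarrow> u t \<bullet> u t = 1"
  using polytope by (simp add: compact_polytope_def)

lemma gram_self: "t \<in> T \<Longrightarrow> gram t t = 1"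
  by (simp add: gram_def u_unit)

lemma gram_sym: "s \<in> T \<Longrightarrow> t \<in> T \<Longrightarrow> gram s t = gram t s"
  by (simp add: gram_def comm_scalar_prod[of _ d])

lemma interior_carrier: "y \<in> interior \<Longrightarrow> y \<in> carrier_vec d"
  by (simp add: polytope_interior_def)

lemma interior_height: "y \<in> interior \<Longrightarrow> t \<in> T \<Longrightarrow> height y t < 0"
  by (simp add: polytope_interior_def height_def)

lemma action_Bij: "g \<in> carrier G \<Longrightarrow> \<rho> g \<in> Bij (carrier_vec d)"
  using hom by (auto simp: hom_def BijGroup_def)

lemma action_closed: "g \<in> carrier G \<Longrightarrow> y \<in> carrier_vec d \<Longrightarrow> \<rho> g y \<in> carrier_vec d"
  using action_Bij Bij_imp_funcset by blast

lemma action_mult: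
  assumes "g \<in> carrier G" "h \<in> carrier G" "y \<in> carrier_vec d"
  shows "\<rho> (g \<otimes> h) y = \<rho> g (\<rho> h y)"
proof -
  have "\<rho> (g \<otimes> h) = compose (carrier_vec d) (\<rho> g) (\<rho> h)"
    using hom assms action_Bij by (simp add: hom_def BijGroup_def)
  then show ?thesis using assms by (simp add: compose_def)
qed

lemma action_one: "y \<in> carrier_vec d \<Longrightarrow> \<rho> \<one> y = y"
proof -
  assume "y \<in> carrier_vec d"
  moreover have "\<rho> \<one> = \<one>\<^bsub>BijGroup (carrier_vec d)\<^esub>"
    using hom group_BijGroup by (intro hom_one) auto
  ultimately show ?thesis by (simp add: BijGroup_def)
qed

lemma action_reflection:
  "t \<in> T \<Longrightarrow> y \<in> carrier_vec d \<Longrightarrow> \<rho> t y = y - (2 * height y t) \<cdot>\<^sub>v u t"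
  by (simp add: reflection hyperplane_reflection_def height_def)

lemma height_reflection:
  assumes "t \<in> T" "y \<in> carrier_vec d"
  shows "height (\<rho> t y) = reflect gram t (height y)"
proof
  fix r
  show "height (\<rho> t y) r = reflect gram t (height y) r"
  proof (cases "r \<in> T")
    case True
    have "u r \<bullet> (y - (2 * height y t) \<cdot>\<^sub>v u t) = u r \<bullet> y - u r \<bullet> ((2 * height y t) \<cdot>\<^sub>v u t)"
      using assms True by (intro scalar_prod_minus_distrib[of _ d]) auto
    also have "u r \<bullet> ((2 * height y t) \<cdot>\<^sub>v u t) = 2 * height y t * (u t \<bullet> u r)"
      using assms True comm_scalar_prod[of "u r" d "u t"] by simp
    finally show ?thesis
      using assms True by (simp add: action_reflection reflect_def gram_def) (simp add: height_def)
  next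
    case False
    then show ?thesis using assms by (simp add: reflect_def height_def gram_def)
  qed
qed

lemma word_closed: "w \<in> lists T \<Longrightarrow> word_value G w \<in> carrier G"
  using T_carrier by (induction w) (auto simp: word_value_def)

lemma height_word:
  assumes "w \<in> lists T" "y \<in> carrier_vec d"
  shows "height (\<rho> (word_value G (rev w)) y) = act gram w (height y)"
  using assms(1)
proof (induction w rule: rev_induct)
  case Nil
  then show ?case using assms(2) by (simp add: word_value_def action_one)
next
  case (snoc t w)
  have tw: "t \<in> T" "t \<in> carrier G" "w \<in> lists T" using snoc.prems T_carrier by auto
  then have w: "word_value G (rev w) \<in> carrier G" by (intro word_closed) simp
  have "\<rho> (word_value G (rev (w @ [t]))) y = \<rho> t (\<rho> (word_value G (rev w)) y)"
    using tw w assms(2) by (simp add: word_value_def action_mult)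
  then show ?case using snoc.IH tw w assms(2) by (simp add: height_reflection action_closed)
qed

lemma fixes_interior_point:
  assumes "g \<in> carrier G" "y \<in> interior" "\<rho> g y = y"
  shows "g = \<one>"
  using disjoint[OF assms(1)] assms(2,3) by (metis disjoint_iff image_eqI)

text \<open>
  The interior meets no reflection hyperplane of the group: if \<open>h y\<close> lies on the wall of \<open>t\<close>, then the
  reflection \<open>h\<inverse> t h\<close> fixes the point \<open>y\<close> of the interior, so it is trivial, and then so is \<open>t\<close>, which
  nevertheless moves \<open>y\<close>.
\<close>

lemma interior_misses_walls:
  assumes "y \<in> interior" "w \<in> lists T" "t \<in> T"
  shows "act gram w (height y) t \<noteq> 0"
proof
  assume zero: "act gram w (height y) t = 0"
  have y: "y \<in> carrier_vec d" using assms(1) by (rule interior_carrier)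
  define h where "h = word_value G (rev w)"
  have h: "h \<in> carrier G" unfolding h_def using assms(2) by (intro word_closed) simp
  have t: "t \<in> carrier G" using assms(3) T_carrier by auto
  define z where "z = \<rho> h y"
  have z: "z \<in> carrier_vec d" unfolding z_def using h y by (rule action_closed)
  have "height z t = 0"
    using zero height_word[OF assms(2) y] by (simp add: z_def h_def)
  then have tz: "\<rho> t z = z" using z assms(3) by (auto simp: action_reflection intro!: eq_vecI)
  have "\<rho> (inv h \<otimes> (t \<otimes> h)) y = \<rho> (inv h) (\<rho> t z)"
    using h t y by (simp add: action_mult z_def)
  also have "\<dots> = \<rho> (inv h \<otimes> h) y" unfolding tz unfolding z_def using h y action_mult[of "inv h" h y] by simp
  also have "\<dots> = y" using h y by (simp add: action_one)
  finally have "inv h \<otimes> (t \<otimes> h) = \<one>" using assms(1) h t by (intro fixes_interior_point) auto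
  then have "t \<otimes> h = \<one> \<otimes> h" using h t by (metis inv_closed inv_equality inv_inv l_one m_closed inv_comm)
  then have "t = \<one>" using h t by (simp)
  then have "height y = reflect gram t (height y)"
    using height_reflection[OF assms(3) y] action_one[OF y] by simp
  then have "height y t = - height y t"
    using reflect_self[of gram t "height y"] gram_self assms(3) by simp
  then show False using interior_height[OF assms(1,3)] by simp
qed

text \<open>
  The heights above two walls can be in any given ratio: on the segment from a point in the face of
  \<open>s\<close> to a point in the face of \<open>t\<close>, the ratio runs through all positive numbers.
\<close>

lemma interior_point_with_ratio:
  assumes "s \<in> T" "t \<in> T" "s \<noteq> t" "0 < a" "0 < b"
  obtains y \<kappa> where "y \<in> interior" "0 < \<kappa>" "height y s = - (\<kappa> * a)" "height y t = - (\<kappa> * b)"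
proof -
  have "\<forall>t\<in>T. \<exists>x \<in> carrier_vec d. u t \<bullet> x = c t \<and> (\<forall>s \<in> T - {t}. u s \<bullet> x < c s)"
    using polytope by (simp add: compact_polytope_def)
  then obtain x z where x: "x \<in> carrier_vec d" "u s \<bullet> x = c s" "\<forall>r \<in> T - {s}. u r \<bullet> x < c r"
    and z: "z \<in> carrier_vec d" "u t \<bullet> z = c t" "\<forall>r \<in> T - {t}. u r \<bullet> z < c r"
    using assms by meson
  define e where "e = c s - u s \<bullet> z"
  define f where "f = c t - u t \<bullet> x"
  have ef: "0 < e" "0 < f" unfolding e_def f_def using x z assms by auto
  define D where "D = a * f + b * e"
  have D: "0 < D" unfolding D_def using ef assms by (simp add: add_pos_pos)
  define l where "l = a * f / D"
  define k where "k = b * e / D"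
  have l: "0 < l" "0 < k" "l + k = 1"
    unfolding l_def k_def using ef assms D by (simp_all add: D_def flip: add_divide_distrib)
  define y where "y = k \<cdot>\<^sub>v x + l \<cdot>\<^sub>v z"
  have y: "y \<in> carrier_vec d" unfolding y_def using x z by simp
  have uy: "u r \<bullet> y - c r = k * (u r \<bullet> x - c r) + l * (u r \<bullet> z - c r)" if "r \<in> T" for r
  proof -
    have "u r \<bullet> y = k * (u r \<bullet> x) + l * (u r \<bullet> z)"
      unfolding y_def using x z that by (simp add: scalar_prod_add_distrib[of _ d])
    moreover have "c r = k * c r + l * c r" using l(3) by (simp flip: distrib_right add: add.commute)
    ultimately show ?thesis by (simp add: algebra_simps)
  qed
  have "u r \<bullet> y - c r < 0" if "r \<in> T" for r
  proof (cases "r = s")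
    case True
    then show ?thesis using uy[OF that] x z l assms ef by (simp add: e_def mult_pos_neg)
  next
    case False
    then have "k * (u r \<bullet> x - c r) < 0" using x l that by (simp add: mult_pos_neg)
    moreover have "l * (u r \<bullet> z - c r) \<le> 0"
      using z l that by (cases "r = t") (simp_all add: mult_nonneg_nonpos less_imp_le)
    ultimately show ?thesis using uy[OF that] by simp
  qed
  then have "y \<in> interior" using y by (simp add: polytope_interior_def)
  moreover have "0 < e * f / D" using ef D by simp
  moreover have "u s \<bullet> z - c s = - e" "u t \<bullet> x - c t = - f" by (simp_all add: e_def f_def)
  then have "height y s = - ((e * f / D) * a)" "height y t = - ((e * f / D) * b)"
    using assms uy[of s] uy[of t] x(2) z(2) by (simp_all add: height_def l_def k_def)
  ultimately show thesis using that by blast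
qed

text \<open>
  The two numbers are, up to sign, the coefficients of the heights above \<open>s\<close> and \<open>t\<close> in the equation of a
  reflection hyperplane of the group. If they had opposite signs, some ratio of the two heights
  would solve the equation, and the interior contains a point with this ratio.
\<close>

lemma cheb_same_sign:
  assumes "s \<in> T" "t \<in> T" "s \<noteq> t"
  shows "0 \<le> cheb (- gram s t) (Suc n) * cheb (- gram s t) n"
proof (rule ccontr)
  define U where "U = cheb (- gram s t)"
  assume "\<not> 0 \<le> cheb (- gram s t) (Suc n) * cheb (- gram s t) n"
  then have neg: "U (Suc n) * U n < 0" by (simp add: U_def)
  then have nz: "0 < \<bar>U (Suc n)\<bar>" "0 < \<bar>U n\<bar>" by auto
  define a where "a = (if even n then \<bar>U n\<bar> else \<bar>U (Suc n)\<bar>)"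
  define b where "b = (if even n then \<bar>U (Suc n)\<bar> else \<bar>U n\<bar>)"
  have ab: "0 < a" "0 < b" using nz by (auto simp: a_def b_def)
  obtain y \<kappa> where y: "y \<in> interior" "0 < \<kappa>" "height y s = - (\<kappa> * a)" "height y t = - (\<kappa> * b)"
    using interior_point_with_ratio[OF assms ab] .
  have "act gram (alt s t n) (height y) s = U (Suc n) * (if even n then height y s else height y t)
      + U n * (if even n then height y t else height y s)"
    unfolding U_def using assms gram_self gram_sym[of t s] by (intro act_alt) auto
  also have "\<dots> = - \<kappa> * (U (Suc n) * \<bar>U n\<bar> + U n * \<bar>U (Suc n)\<bar>)"
    using y(3,4) by (simp add: a_def b_def algebra_simps)
  also have "U (Suc n) * \<bar>U n\<bar> + U n * \<bar>U (Suc n)\<bar> = 0"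
    using neg by (auto simp: abs_if mult_less_0_iff)
  finally show False
    using interior_misses_walls[OF y(1) alt_in_lists[OF assms(1,2)] assms(1)] by simp
qed

lemma gram_ge: "s \<in> T \<Longrightarrow> t \<in> T \<Longrightarrow> - 1 \<le> gram s t"
proof -
  assume st: "s \<in> T" "t \<in> T"
  have "0 \<le> (u s + u t) \<bullet> (u s + u t)" by (rule scalar_prod_self_nonneg)
  also have "\<dots> = 2 + 2 * (u s \<bullet> u t)"
    using st u_unit comm_scalar_prod[of "u t" d "u s"]
    by (simp add: scalar_prod_add_distrib[of _ d] add_scalar_prod_distrib[of _ d])
  finally show ?thesis using st by (simp add: gram_def)
qed

lemma word_displacement:
  assumes "s \<in> T" "t \<in> T" "y \<in> carrier_vec d" "w \<in> lists {s, t}"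
  shows "\<exists>a b. \<rho> (word_value G w) y = y + (a \<cdot>\<^sub>v u s + b \<cdot>\<^sub>v u t)"
  using assms(4)
proof (induction w)
  case Nil
  have "y = y + (0 \<cdot>\<^sub>v u s + 0 \<cdot>\<^sub>v u t)" using assms(1-3) by (intro eq_vecI) auto
  then show ?case using assms(3) by (simp add: word_value_def action_one) metis
next
  case (Cons x w)
  then obtain a b where ab: "\<rho> (word_value G w) y = y + (a \<cdot>\<^sub>v u s + b \<cdot>\<^sub>v u t)" by auto
  have x: "x \<in> T" "x \<in> carrier G" using Cons.hyps assms T_carrier by auto
  have w: "word_value G w \<in> carrier G"
    using Cons.hyps assms lists_mono[of "{s, t}" T] by (intro word_closed) auto
  define e where "e = 2 * height (\<rho> (word_value G w) y) x"
  have eq: "\<rho> (word_value G (x # w)) y = (y + (a \<cdot>\<^sub>v u s + b \<cdot>\<^sub>v u t)) - e \<cdot>\<^sub>v u x"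
    using x w assms(3) action_closed[OF w assms(3)] ab
    by (simp add: word_value_def action_mult e_def action_reflection)
  have dim: "dim_vec y = d" "dim_vec (u s) = d" "dim_vec (u t) = d"
    using assms u_carrier by (auto simp: carrier_vecD)
  consider "x = s" | "x = t" using Cons.hyps by auto
  then show ?case
  proof cases
    case 1
    have "(y + (a \<cdot>\<^sub>v u s + b \<cdot>\<^sub>v u t)) - e \<cdot>\<^sub>v u x = y + ((a - e) \<cdot>\<^sub>v u s + b \<cdot>\<^sub>v u t)"
      using dim 1 by (intro eq_vecI) (auto simp: algebra_simps)
    then show ?thesis using eq by metis
  next
    case 2
    have "(y + (a \<cdot>\<^sub>v u s + b \<cdot>\<^sub>v u t)) - e \<cdot>\<^sub>v u x = y + (a \<cdot>\<^sub>v u s + (b - e) \<cdot>\<^sub>v u t)"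
      using dim 2 by (intro eq_vecI) (auto simp: algebra_simps)
    then show ?thesis using eq by metis
  qed
qed

text \<open>
  The rotation by \<open>2\<pi>/k\<close> preserves all heights, and it moves points only within the plane spanned by
  the two normals. So it fixes every point; since it fixes one in the interior, it comes from the
  trivial element.
\<close>

lemma relator_of_angle:
  assumes "s \<in> T" "t \<in> T" "2 \<le> k" "gram s t = - cos (pi / real k)"
  shows "word_value G (concat (replicate k [s, t])) = \<one>"
proof -
  define w where "w = concat (replicate k [s, t])"
  have w: "w \<in> lists {s, t}" "w \<in> lists T"
    unfolding w_def using assms by (auto intro: relator_in_lists)
  have rev_w: "rev w = concat (replicate k [t, s])"
    unfolding w_def by (simp add: rev_concat)
  have "interior \<noteq> {}" using polytope by (simp add: compact_polytope_def)
  then obtain y where y: "y \<in> interior" by blast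
  then have yc: "y \<in> carrier_vec d" by (rule interior_carrier)
  have "height (\<rho> (word_value G w) y) = act gram (rev w) (height y)"
    using height_word[of "rev w" y] w yc by simp
  also have "\<dots> = height y"
    unfolding rev_w using assms gram_self gram_sym[of t s] by (intro act_relator) auto
  finally have same: "height (\<rho> (word_value G w) y) = height y" .
  obtain a b where ab: "\<rho> (word_value G w) y = y + (a \<cdot>\<^sub>v u s + b \<cdot>\<^sub>v u t)"
    using word_displacement[OF assms(1,2) yc w(1)] by blast
  have prod: "a * (u r \<bullet> u s) + b * (u r \<bullet> u t) = 0" if "r \<in> T" for r
  proof -
    have "u r \<bullet> (\<rho> (word_value G w) y) = u r \<bullet> y"
      using same that by (auto simp: height_def fun_eq_iff split: if_splits)
    then show ?thesis
      unfolding ab using assms that yc by (simp add: scalar_prod_add_distrib[of _ d])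
  qed
  define g where "g = u s \<bullet> u t"
  have ts: "u t \<bullet> u s = g" unfolding g_def using assms by (intro comm_scalar_prod[of _ d]) auto
  have 1: "a + b * g = 0" "a * g + b = 0"
    using prod[OF assms(1)] prod[OF assms(2)] ts u_unit assms by (auto simp: g_def)
  have "0 < sin (pi / real k)" using assms(3) by (intro sin_gt_zero) (auto simp: field_simps)
  then have "(cos (pi / real k))\<^sup>2 \<noteq> 1"
    using sin_cos_squared_add[of "pi / real k"] by (metis add_cancel_left_left less_numeral_extra(3) power_eq_0_iff)
  then have g: "g * g \<noteq> 1" using assms by (auto simp: g_def gram_def power2_eq_square)
  have "b = - (a * g)" using 1 by simp
  then have "a * (1 - g * g) = a + b * g" by (simp add: algebra_simps)
  then have "a * (1 - g * g) = 0" using 1 by simp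
  then have "a = 0" "b = 0" using g 1 by auto
  then have "\<rho> (word_value G w) y = y"
    unfolding ab using assms yc u_carrier by (intro eq_vecI) auto
  then show ?thesis using fixes_interior_point[OF word_closed y] w(2) w_def by blast
qed

text \<open>
  Let \<open>\<theta>\<close> be the angle between the walls and \<open>k\<close> the first number with \<open>k\<theta> \<ge> \<pi>\<close>. The sequence \<open>sin (n\<theta>)\<close> is
  positive for \<open>0 < n < k\<close>, and it may not change its sign from one term to the next, so \<open>sin (k\<theta>) = 0\<close>
  and \<open>k\<theta> = \<pi>\<close>.
\<close>

lemma wall_angle:
  assumes "s \<in> T" "t \<in> T" "s \<noteq> t"
  shows "gram s t = - 1 \<or> (\<exists>k. 2 \<le> k \<and> gram s t = - cos (pi / real k) \<and>
    word_value G (concat (replicate k [s, t])) = \<one>)"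
proof (cases "gram s t = - 1")
  case False
  define \<theta> where "\<theta> = arccos (- gram s t)"
  have lt: "- gram s t < 1" using False gram_ge[OF assms(1,2)] by linarith
  have nonneg: "0 \<le> - gram s t" using cheb_same_sign[OF assms, of 1] by simp
  have cos: "cos \<theta> = - gram s t" unfolding \<theta>_def using lt nonneg by (intro cos_arccos) auto
  have \<theta>: "0 < \<theta>" "\<theta> \<le> pi / 2"
    unfolding \<theta>_def using arccos_less_arccos[of "- gram s t" 1] arccos_le_arccos[of 0 "- gram s t"] lt nonneg
    by auto
  have sin: "0 < sin \<theta>" using \<theta> pi_gt_zero by (intro sin_gt_zero) linarith+
  define P where "P j \<longleftrightarrow> pi \<le> real j * \<theta>" for j :: nat
  have "\<exists>j. P j"
    unfolding P_def using real_arch_simple[of "pi / \<theta>"] \<theta> by (auto simp: field_simps)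
  then obtain k where k: "P k" "\<And>j. j < k \<Longrightarrow> \<not> P j" by (metis LeastI_ex not_less_Least)
  have "\<not> P 0" "\<not> P 1" using \<theta> pi_gt_zero unfolding P_def by auto
  then have "k \<noteq> 0" "k \<noteq> 1" using k(1) by metis+
  then have k2: "2 \<le> k" by simp
  then obtain j where j: "k = Suc j" "1 \<le> j" by (cases k) auto
  have "real j * \<theta> < pi" using k(2)[of j] j by (simp add: P_def)
  moreover have "0 < real j * \<theta>" using j \<theta> by simp
  ultimately have "0 < sin (real j * \<theta>)" by (intro sin_gt_zero)
  then have "0 < sin \<theta> * cheb (cos \<theta>) j" by (simp add: cheb_sin)
  then have "0 < cheb (cos \<theta>) j" using sin by (simp add: zero_less_mult_iff)
  then have "0 \<le> cheb (cos \<theta>) k"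
    using cheb_same_sign[OF assms, of j] by (simp add: cos j zero_le_mult_iff del: cheb.simps)
  then have "0 \<le> sin (real k * \<theta>)" using cheb_sin[of \<theta> k] sin by (metis less_imp_le mult_nonneg_nonneg)
  then have "sin (real k * \<theta> - pi) \<le> 0" by (simp add: sin_diff)
  moreover have "0 \<le> real k * \<theta> - pi" using k(1) by (simp add: P_def)
  moreover have "real k * \<theta> - pi < pi"
    using \<open>real j * \<theta> < pi\<close> \<theta> pi_gt_zero j by (simp add: algebra_simps)
  ultimately have "real k * \<theta> = pi" using sin_gt_zero[of "real k * \<theta> - pi"] by linarith
  then have "\<theta> = pi / real k" using k2 by (simp add: field_simps)
  then have "gram s t = - cos (pi / real k)" using cos by simp
  then show ?thesis using k2 relator_of_angle[OF assms(1,2) k2] by blast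
qed simp

end

lemma affine_coxeter_iso:
  assumes G: "group G" and G': "group G'" and \<phi>: "\<phi> \<in> iso G G'" and T: "T \<subseteq> carrier G" and aff: "affine_coxeter G T"
  shows "affine_coxeter G' (\<phi> ` T)"
proof -
  obtain d u c \<rho> where *: "compact_polytope d T u c" "\<rho> \<in> hom G (BijGroup (carrier_vec d))"
      "\<forall>t\<in>T. \<rho> t = hyperplane_reflection d (u t) (c t)"
      "(\<Union>g\<in>carrier G. \<rho> g ` halfspace_polytope d T u c) = carrier_vec d"
      "\<forall>g\<in>carrier G. g \<noteq> \<one>\<^bsub>G\<^esub> \<longrightarrow>
        \<rho> g ` polytope_interior d T u c \<inter> polytope_interior d T u c = {}"
    using aff unfolding affine_coxeter_def by (elim exE conjE)
  define \<psi> where "\<psi> = inv_into (carrier G) \<phi>"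
  have \<psi>: "\<psi> \<in> iso G' G" unfolding \<psi>_def using group.iso_set_sym[OF G \<phi>] .
  have bij: "inj_on \<phi> (carrier G)" using \<phi> by (simp add: iso_def bij_betw_def)
  have inv: "\<psi> (\<phi> t) = t" if "t \<in> T" for t
    unfolding \<psi>_def using bij T that by (auto intro: inv_into_f_f)
  have surj: "\<psi> ` carrier G' = carrier G" using \<psi> by (simp add: iso_def bij_betw_def)
  have inj': "inj_on \<psi> (carrier G')" using \<psi> by (simp add: iso_def bij_betw_def)
  have minus: "\<phi> ` T - {\<phi> t} = \<phi> ` (T - {t})" if "t \<in> T" for t
    using inv that by (auto simp: image_iff) metis+
  have half: "halfspace_polytope d (\<phi> ` T) (u \<circ> \<psi>) (c \<circ> \<psi>) = halfspace_polytope d T u c"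
    by (auto simp: halfspace_polytope_def inv)
  have int: "polytope_interior d (\<phi> ` T) (u \<circ> \<psi>) (c \<circ> \<psi>) = polytope_interior d T u c"
    by (auto simp: polytope_interior_def inv)
  have "compact_polytope d (\<phi> ` T) (u \<circ> \<psi>) (c \<circ> \<psi>)"
    using *(1) unfolding compact_polytope_def half int by (auto simp: inv minus)
  moreover have "\<rho> \<circ> \<psi> \<in> hom G' (BijGroup (carrier_vec d))"
    using \<psi> *(2) hom_compose unfolding iso_def by blast
  moreover have "\<forall>t\<in>\<phi> ` T. (\<rho> \<circ> \<psi>) t = hyperplane_reflection d ((u \<circ> \<psi>) t) ((c \<circ> \<psi>) t)"
    using *(3) inv by simp
  moreover have "(\<Union>g\<in>carrier G'. (\<rho> \<circ> \<psi>) g ` halfspace_polytope d T u c) = carrier_vec d"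
  proof -
    have "(\<Union>g\<in>carrier G'. (\<rho> \<circ> \<psi>) g ` halfspace_polytope d T u c) =
        (\<Union>g\<in>\<psi> ` carrier G'. \<rho> g ` halfspace_polytope d T u c)"
      by simp
    then show ?thesis by (simp only: surj *(4))
  qed
  moreover have "(\<rho> \<circ> \<psi>) g ` polytope_interior d T u c \<inter> polytope_interior d T u c = {}"
    if g: "g \<in> carrier G'" "g \<noteq> \<one>\<^bsub>G'\<^esub>" for g
  proof -
    have "\<psi> \<one>\<^bsub>G'\<^esub> = \<one>\<^bsub>G\<^esub>" using hom_one[OF _ G' G] \<psi> by (auto simp: iso_def)
    then have "\<psi> g \<noteq> \<one>\<^bsub>G\<^esub>"
      using inj_onD[OF inj' _ g(1) monoid.one_closed[OF group.is_monoid[OF G']]] g(2) by auto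
    moreover have "\<psi> g \<in> carrier G" using surj g by blast
    ultimately have "\<rho> (\<psi> g) ` polytope_interior d T u c \<inter> polytope_interior d T u c = {}"
      using *(5) by blast
    then show ?thesis by simp
  qed
  ultimately show ?thesis
    unfolding affine_coxeter_def
    by (intro exI[of _ d] exI[of _ "u \<circ> \<psi>"] exI[of _ "c \<circ> \<psi>"] exI[of _ "\<rho> \<circ> \<psi>"]) (simp add: half int)
qed

context coxeter
begin

text \<open>
  Walls with an angle \<open>\<pi>/k\<close> satisfy \<open>(st)\<^sup>k = 1\<close>, so \<open>k\<close> is at least the order \<open>m(s,t)\<close> of \<open>st\<close>. If the order is
  infinite, the walls are parallel.
\<close>

lemma affine_wall_normals:
  assumes "T \<subseteq> S" "affine_subset W T"
  obtains d u where "\<And>t. t \<in> T \<Longrightarrow> u t \<in> carrier_vec d" "\<And>t. t \<in> T \<Longrightarrow> u t \<bullet> u t = 1"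
    and "\<And>s t. s \<in> T \<Longrightarrow> t \<in> T \<Longrightarrow> s \<noteq> t \<Longrightarrow> u s \<bullet> u t \<le> B s t"
proof -
  let ?G = "subgroup_generated W T"
  obtain d u c \<rho> where *: "compact_polytope d T u c" "\<rho> \<in> hom ?G (BijGroup (carrier_vec d))"
      "\<forall>t\<in>T. \<rho> t = hyperplane_reflection d (u t) (c t)"
      "\<forall>g\<in>carrier ?G. g \<noteq> \<one>\<^bsub>?G\<^esub> \<longrightarrow>
        \<rho> g ` polytope_interior d T u c \<inter> polytope_interior d T u c = {}"
    using assms(2) unfolding affine_subset_def affine_coxeter_def by (elim exE conjE)
  interpret A: chamber_action ?G T d u c \<rho>
  proof (rule chamber_action.intro)
    show "group ?G" by (rule group_subgroup_generated)
    show "T \<subseteq> carrier ?G" using assms(1) S_carrier subgroup_generated_subset_carrier_subset[of T] by auto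
  qed (use * in auto)
  have val: "word_value ?G w = val w" for w
    by (simp add: word_value_def subgroup_generated_def)
  have "u s \<bullet> u t \<le> B s t" if st: "s \<in> T" "t \<in> T" "s \<noteq> t" for s t
  proof -
    have gram: "A.gram s t = u s \<bullet> u t" using st by (simp add: A.gram_def)
    show ?thesis using A.wall_angle[OF st]
    proof (elim disjE exE conjE)
      assume "A.gram s t = - 1"
      then show ?thesis using gram by (simp add: cos_matrix_def split: enat.split)
    next
      fix k assume k: "2 \<le> k" "A.gram s t = - cos (pi / real k)"
        "word_value ?G (concat (replicate k [s, t])) = \<one>\<^bsub>?G\<^esub>"
      have "m s t \<le> enat k"
        using st assms(1) k by (intro order_ge_m) (auto simp: val)
      then obtain j where j: "m s t = enat j" "j \<le> k" by (cases "m s t") auto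
      have "2 \<le> j" using m_ge_2[of s t] st assms(1) j by (auto simp: numeral_eq_enat)
      then have "pi / real k \<le> pi / real j" "0 \<le> pi / real k" "pi / real j \<le> pi"
        using j(2) by (auto simp: field_simps)
      then have "cos (pi / real j) \<le> cos (pi / real k)" by (intro cos_monotone_0_pi_le)
      then show ?thesis using k(2) gram j(1) by (simp add: cos_matrix_def)
    qed
  qed
  then show thesis using that[of u d] A.u_carrier A.u_unit by blast
qed

text \<open>
  The vector \<open>\<surd>3 u(p) + 2 u(q) + u(t)\<close> would have negative square. For the label \<open>6\<close> it may be \<open>0\<close>, as in the
  affine triangle group with labels \<open>6\<close>, \<open>3\<close>, \<open>2\<close>.
\<close>

lemma large_label_not_affine:
  assumes "T \<subseteq> S" "p \<in> T" "q \<in> T" "t \<in> T" "p \<noteq> q" "t \<noteq> p" "t \<noteq> q"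
    and pq: "7 \<le> m p q" and qt: "m q t \<noteq> 2"
  shows "\<not> affine_subset W T"
proof
  assume "affine_subset W T"
  then obtain d u where u: "\<And>t. t \<in> T \<Longrightarrow> u t \<in> carrier_vec d" "\<And>t. t \<in> T \<Longrightarrow> u t \<bullet> u t = 1"
    and le: "\<And>s t. s \<in> T \<Longrightarrow> t \<in> T \<Longrightarrow> s \<noteq> t \<Longrightarrow> u s \<bullet> u t \<le> B s t"
    using affine_wall_normals[OF assms(1)] by metis
  have in_S: "p \<in> S" "q \<in> S" "t \<in> S" using assms by auto
  have "B p q \<le> - cos (pi / real 7)"
    using pq by (intro B_le) (auto simp: numeral_eq_enat)
  moreover have "cos (pi / 6) < cos (pi / 7)" by (intro cos_monotone_0_pi) auto
  ultimately have "B p q < - (sqrt 3 / 2)" by (simp add: cos_30)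
  then have Bpq: "u p \<bullet> u q < - (sqrt 3 / 2)" using le[of p q] assms by simp
  have "enat 3 \<le> m q t"
    using m_ge_2[of q t] qt in_S assms(7) by (cases "m q t") (auto simp: numeral_eq_enat)
  then have "B q t \<le> - cos (pi / real 3)" by (intro B_le) auto
  then have Bqt: "u q \<bullet> u t \<le> - (1 / 2)" using le[of q t] assms by (simp add: cos_60)
  have Bpt: "u p \<bullet> u t \<le> 0"
    using le[of p t] B_nonpos[of p t] in_S assms by simp
  define r where "r = sqrt (3::real)"
  have r: "r * r = 3" "0 < r" unfolding r_def by auto
  define v where "v = r \<cdot>\<^sub>v u p + 2 \<cdot>\<^sub>v u q + u t"
  have c: "u p \<in> carrier_vec d" "u q \<in> carrier_vec d" "u t \<in> carrier_vec d"
    using u assms by auto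
  have "0 \<le> v \<bullet> v" by (rule scalar_prod_self_nonneg)
  also have "v \<bullet> v = r * r * (u p \<bullet> u p) + 4 * (u q \<bullet> u q) + u t \<bullet> u t + 4 * (r * (u p \<bullet> u q))
      + 4 * (u q \<bullet> u t) + 2 * (r * (u p \<bullet> u t))"
  proof -
    have sym: "u q \<bullet> u p = u p \<bullet> u q" "u t \<bullet> u p = u p \<bullet> u t" "u t \<bullet> u q = u q \<bullet> u t"
      using c by (auto intro: comm_scalar_prod)
    show ?thesis
      unfolding v_def using c
      by (simp add: scalar_prod_add_distrib[of _ d] add_scalar_prod_distrib[of _ d]
          scalar_prod_smult_distrib[of _ d] smult_scalar_prod_distrib[of _ d] sym)
        (simp add: algebra_simps)
  qed
  also have "\<dots> = 8 + 4 * (r * (u p \<bullet> u q)) + 4 * (u q \<bullet> u t) + 2 * (r * (u p \<bullet> u t))"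
    using u assms r by simp
  finally have "0 \<le> 8 + 4 * (r * (u p \<bullet> u q)) + 4 * (u q \<bullet> u t) + 2 * (r * (u p \<bullet> u t))" .
  moreover have "r * (u p \<bullet> u q) < r * (- (r / 2))"
    using Bpq r unfolding r_def[symmetric] by (intro mult_strict_left_mono) auto
  moreover have "r * (u p \<bullet> u t) \<le> 0" using r Bpt by (simp add: mult_le_0_iff)
  ultimately show False using Bqt r(1) by simp
qed

lemma irreducible_large_label_not_affine:
  assumes "T \<subseteq> S" "p \<in> T" "q \<in> T" "p \<noteq> q" "7 \<le> m p q" "irreducible_subset W T" "3 \<le> card T"
  shows "\<not> affine_subset W T"
proof -
  have "T - {p, q} \<noteq> {}"
  proof
    assume "T - {p, q} = {}"
    then have "card T \<le> card {p, q}" by (intro card_mono) auto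
    then show False using assms(4,7) by simp
  qed
  moreover have "{p, q} \<union> (T - {p, q}) = T" using assms by auto
  ultimately have "\<not> disjoint_commuting W {p, q} (T - {p, q})"
    using assms(6) unfolding irreducible_subset_def by (metis insert_not_empty)
  then obtain x t where xt: "x \<in> {p, q}" "t \<in> T - {p, q}" "x \<otimes> t \<noteq> t \<otimes> x"
    unfolding disjoint_commuting_def by blast
  then have "m x t \<noteq> 2" using commute_iff[of x t] assms by auto
  moreover have "m q p = m p q" using assms by (intro m_sym) auto
  ultimately show ?thesis
    using xt assms(1-5) large_label_not_affine[OF assms(1-3), of t]
      large_label_not_affine[OF assms(1,3,2), of t] by fastforce
qed

end

section \<open>Changing one large label\<close>

text \<open>
  Here \<open>p\<close> and \<open>q\<close> are generators rather than indices. The two systems play symmetric roles, so what holds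
  for \<open>W\<close> alone is also available for \<open>W'\<close>.
\<close>

locale large_label_change =
  C: coxeter W S m + C': coxeter W' S' m'
  for W :: "('a, 'c) monoid_scheme" and S m
    and W' :: "('b, 'd) monoid_scheme" and S' m' +
  fixes \<iota> :: "'a \<Rightarrow> 'b" and p q :: 'a
  assumes bij: "bij_betw \<iota> S S'"
    and pq: "p \<in> S" "q \<in> S" "p \<noteq> q"
    and same: "\<And>s t. s \<in> S \<Longrightarrow> t \<in> S \<Longrightarrow> {s, t} \<noteq> {p, q} \<Longrightarrow> m' (\<iota> s) (\<iota> t) = m s t"
    and large: "7 \<le> m p q" "m p q \<noteq> \<infinity>" "7 \<le> m' (\<iota> p) (\<iota> q)" "m' (\<iota> p) (\<iota> q) \<noteq> \<infinity>"
begin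

lemma inj: "inj_on \<iota> S"
  using bij by (simp add: bij_betw_def)

lemma image_S: "\<iota> ` S = S'"
  using bij by (simp add: bij_betw_def)

lemma image_subset_image_iff: "A \<subseteq> S \<Longrightarrow> B \<subseteq> S \<Longrightarrow> \<iota> ` A \<subseteq> \<iota> ` B \<longleftrightarrow> A \<subseteq> B"
  using inj by (auto simp: inj_on_def) blast

lemma image_subset: "T \<subseteq> S \<Longrightarrow> \<iota> ` T \<subseteq> S'"
  using image_S by blast

lemma image_in: "s \<in> S \<Longrightarrow> \<iota> s \<in> S'"
  using image_S by blast

lemma label_2_iff: 
  assumes "s \<in> S" "t \<in> S"
  shows "m' (\<iota> s) (\<iota> t) = 2 \<longleftrightarrow> m s t = 2"
proof (cases "{s, t} = {p, q}")
  case True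
  have "m q p = m p q" "m' (\<iota> q) (\<iota> p) = m' (\<iota> p) (\<iota> q)"
    using pq C.m_sym C'.m_sym image_in by auto
  moreover have "m p q \<noteq> 2" "m' (\<iota> p) (\<iota> q) \<noteq> 2"
    using large(1,3) by (auto simp: numeral_eq_enat)
  ultimately have "m s t \<noteq> 2" "m' (\<iota> s) (\<iota> t) \<noteq> 2"
    using True by (auto simp: doubleton_eq_iff)
  then show ?thesis by simp
qed (use assms same in simp)

lemma commute_image_iff:
  assumes "s \<in> S" "t \<in> S"
  shows "\<iota> s \<otimes>\<^bsub>W'\<^esub> \<iota> t = \<iota> t \<otimes>\<^bsub>W'\<^esub> \<iota> s \<longleftrightarrow> s \<otimes>\<^bsub>W\<^esub> t = t \<otimes>\<^bsub>W\<^esub> s"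
proof (cases "s = t")
  case False
  then have "\<iota> s \<noteq> \<iota> t" using inj assms by (auto dest: inj_onD)
  then show ?thesis
    using False assms C.commute_iff C'.commute_iff image_in label_2_iff by simp
qed simp

lemma disjoint_commuting_image_iff:
  assumes "A \<subseteq> S" "B \<subseteq> S"
  shows "disjoint_commuting W' (\<iota> ` A) (\<iota> ` B) \<longleftrightarrow> disjoint_commuting W A B"
proof -
  have "\<iota> ` A \<inter> \<iota> ` B = {} \<longleftrightarrow> A \<inter> B = {}"
    using inj_on_image_Int[OF inj assms] by (metis image_is_empty)
  moreover have "(\<forall>a\<in>\<iota> ` A. \<forall>b\<in>\<iota> ` B. a \<otimes>\<^bsub>W'\<^esub> b = b \<otimes>\<^bsub>W'\<^esub> a) \<longleftrightarrow>
      (\<forall>a\<in>A. \<forall>b\<in>B. a \<otimes>\<^bsub>W\<^esub> b = b \<otimes>\<^bsub>W\<^esub> a)"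
    using commute_image_iff assms by (auto simp: subset_iff)
  ultimately show ?thesis unfolding disjoint_commuting_def by blast
qed

lemma image_eq_iff: "A \<subseteq> S \<Longrightarrow> B \<subseteq> S \<Longrightarrow> \<iota> ` A = \<iota> ` B \<longleftrightarrow> A = B"
  by (rule inj_on_image_eq_iff[OF inj])

lemma irreducible_image_iff:
  assumes "T \<subseteq> S"
  shows "irreducible_subset W' (\<iota> ` T) \<longleftrightarrow> irreducible_subset W T"
proof -
  have partition: "(\<exists>A B. A \<noteq> {} \<and> B \<noteq> {} \<and> A \<union> B = T \<and> disjoint_commuting W A B) \<longleftrightarrow>
    (\<exists>A' B'. A' \<noteq> {} \<and> B' \<noteq> {} \<and> A' \<union> B' = \<iota> ` T \<and> disjoint_commuting W' A' B')"
  proof (intro iffI; elim exE conjE)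
    fix A B assume AB: "A \<noteq> {}" "B \<noteq> {}" "A \<union> B = T" "disjoint_commuting W A B"
    moreover from this have "A \<subseteq> S" "B \<subseteq> S" using assms by auto
    ultimately show "\<exists>A' B'. A' \<noteq> {} \<and> B' \<noteq> {} \<and> A' \<union> B' = \<iota> ` T \<and> disjoint_commuting W' A' B'"
      by (intro exI[of _ "\<iota> ` A"] exI[of _ "\<iota> ` B"]) (auto simp: disjoint_commuting_image_iff)
  next
    fix A' B' assume AB: "A' \<noteq> {}" "B' \<noteq> {}" "A' \<union> B' = \<iota> ` T" "disjoint_commuting W' A' B'"
    then obtain A B where eq: "A \<subseteq> T" "A' = \<iota> ` A" "B \<subseteq> T" "B' = \<iota> ` B"
      by (metis subset_image_iff sup_ge1 sup_ge2)
    then have sub: "A \<subseteq> S" "B \<subseteq> S" using assms by auto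
    have "\<iota> ` (A \<union> B) = \<iota> ` T" using AB(3) eq by auto
    then have "A \<union> B = T" using image_eq_iff[of "A \<union> B" T] sub assms by simp
    then show "\<exists>A B. A \<noteq> {} \<and> B \<noteq> {} \<and> A \<union> B = T \<and> disjoint_commuting W A B"
      using AB(1,2,4) disjoint_commuting_image_iff[OF sub] unfolding eq by blast
  qed
  show ?thesis unfolding irreducible_subset_def by (simp only: partition)
qed

lemma card_image_eq: "T \<subseteq> S \<Longrightarrow> card (\<iota> ` T) = card T"
  using inj by (meson card_image inj_on_subset)

lemma iso_of_unchanged:
  assumes "T \<subseteq> S" "\<not> {p, q} \<subseteq> T"
  obtains \<phi> where "\<phi> \<in> iso (subgroup_generated W T) (subgroup_generated W' (\<iota> ` T))"
    and "\<And>t. t \<in> T \<Longrightarrow> \<phi> t = \<iota> t"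
proof (rule special_subgroup_iso[OF C.coxeter_axioms C'.coxeter_axioms assms(1) image_subset[OF assms(1)]])
  fix s t assume st: "s \<in> T" "t \<in> T"
  then have "{s, t} \<noteq> {p, q}" using assms(2) by auto
  moreover have "s \<in> S" "t \<in> S" using st assms(1) by auto
  ultimately show "m s t = m' (\<iota> s) (\<iota> t)" using same by simp
qed (use that in blast)

text \<open>
  If \<open>T\<close> contains \<open>p\<close> and \<open>q\<close>, sphericity amounts to a condition on the labels \<open>2\<close> and on \<open>T - {p, q}\<close>, whose
  labels have not changed.
\<close>

lemma spherical_image_iff:
  assumes "T \<subseteq> S"
  shows "spherical W' (\<iota> ` T) \<longleftrightarrow> spherical W T"
proof (cases "{p, q} \<subseteq> T")
  case False
  then obtain \<phi> where "\<phi> \<in> iso (subgroup_generated W T) (subgroup_generated W' (\<iota> ` T))"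
    using iso_of_unchanged[OF assms] by blast
  then show ?thesis using spherical_iso by blast
next
  case True
  have six: "6 \<le> m p q" "6 \<le> m' (\<iota> p) (\<iota> q)"
    using large by (auto simp: numeral_eq_enat intro: order_trans[of _ "enat 7"])
  have diff: "\<iota> ` T - {\<iota> p, \<iota> q} = \<iota> ` (T - {p, q})"
    using inj_on_image_set_diff[OF inj, of T "{p, q}"] True assms pq by auto
  have "\<iota> p \<noteq> \<iota> q" using inj pq by (auto dest: inj_onD)
  then have "spherical W' (\<iota> ` T) \<longleftrightarrow>
    (\<forall>t \<in> \<iota> ` (T - {p, q}). m' (\<iota> p) t = 2 \<and> m' (\<iota> q) t = 2) \<and> spherical W' (\<iota> ` (T - {p, q}))"
    using C'.spherical_large_label_iff[OF image_subset[OF assms], of "\<iota> p" "\<iota> q"] True six large diff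
    by auto
  also have "(\<forall>t \<in> \<iota> ` (T - {p, q}). m' (\<iota> p) t = 2 \<and> m' (\<iota> q) t = 2) \<longleftrightarrow>
      (\<forall>t \<in> T - {p, q}. m p t = 2 \<and> m q t = 2)"
    using label_2_iff pq assms by auto
  also have "spherical W' (\<iota> ` (T - {p, q})) \<longleftrightarrow> spherical W (T - {p, q})"
  proof -
    have "T - {p, q} \<subseteq> S" "\<not> {p, q} \<subseteq> T - {p, q}" using assms by auto
    then obtain \<phi> where "\<phi> \<in> iso (subgroup_generated W (T - {p, q}))
        (subgroup_generated W' (\<iota> ` (T - {p, q})))"
      using iso_of_unchanged by blast
    then show ?thesis using spherical_iso by blast
  qed
  also have "(\<forall>t \<in> T - {p, q}. m p t = 2 \<and> m q t = 2) \<and> spherical W (T - {p, q}) \<longleftrightarrow> spherical W T"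
    using C.spherical_large_label_iff[OF assms, of p q] True six large pq by auto
  finally show ?thesis .
qed

text \<open>
  If \<open>T\<close> contains \<open>p\<close> and \<open>q\<close>, both sides are false.
\<close>

lemma affine_image_iff:
  assumes "T \<subseteq> S" "irreducible_subset W T" "3 \<le> card T"
  shows "affine_subset W' (\<iota> ` T) \<longleftrightarrow> affine_subset W T"
proof (cases "{p, q} \<subseteq> T")
  case True
  have "\<iota> p \<noteq> \<iota> q" using inj pq by (auto dest: inj_onD)
  then have "\<not> affine_subset W' (\<iota> ` T)"
    using True assms large card_image_eq irreducible_image_iff image_subset
    by (intro C'.irreducible_large_label_not_affine[of _ "\<iota> p" "\<iota> q"]) auto
  moreover have "\<not> affine_subset W T"
    using True assms large pq by (intro C.irreducible_large_label_not_affine[of _ p q]) auto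
  ultimately show ?thesis by simp
next
  case False
  let ?G = "subgroup_generated W T" and ?G' = "subgroup_generated W' (\<iota> ` T)"
  obtain \<phi> where \<phi>: "\<phi> \<in> iso ?G ?G'" "\<And>t. t \<in> T \<Longrightarrow> \<phi> t = \<iota> t"
    using iso_of_unchanged[OF assms(1) False] by blast
  have G: "group ?G" "group ?G'"
    by (rule C.group_subgroup_generated, rule C'.group_subgroup_generated)
  have T: "T \<subseteq> carrier ?G" "\<iota> ` T \<subseteq> carrier ?G'"
    using assms(1) image_subset[OF assms(1)] C.S_carrier C'.S_carrier
      C.subgroup_generated_subset_carrier_subset[of T] C'.subgroup_generated_subset_carrier_subset[of "\<iota> ` T"]
    by auto
  have img: "\<phi> ` T = \<iota> ` T" using \<phi>(2) by auto
  define \<psi> where "\<psi> = inv_into (carrier ?G) \<phi>"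
  have \<psi>: "\<psi> \<in> iso ?G' ?G" unfolding \<psi>_def using group.iso_set_sym[OF G(1) \<phi>(1)] .
  have "inj_on \<phi> (carrier ?G)" using \<phi>(1) by (simp add: iso_def bij_betw_def)
  then have img': "\<psi> ` (\<iota> ` T) = T"
    unfolding \<psi>_def img[symmetric] using T(1) by (rule inv_into_image_cancel)
  show ?thesis
    unfolding affine_subset_def
    using affine_coxeter_iso[OF G \<phi>(1) T(1)] affine_coxeter_iso[OF G(2,1) \<psi> T(2)]
    unfolding img img' by (rule iffI[rotated])
qed

lemma minimal_nonspherical_image_iff:
  assumes "T \<subseteq> S"
  shows "minimal_nonspherical W' (\<iota> ` T) \<longleftrightarrow> minimal_nonspherical W T"
proof -
  have "(\<forall>U'. U' \<subset> \<iota> ` T \<longrightarrow> spherical W' U') \<longleftrightarrow> (\<forall>U. U \<subset> T \<longrightarrow> spherical W U)"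
  proof (intro iffI allI impI)
    fix U assume *: "\<forall>U'. U' \<subset> \<iota> ` T \<longrightarrow> spherical W' U'" and U: "U \<subset> T"
    then have "\<iota> ` U \<noteq> \<iota> ` T" using image_eq_iff[of U T] assms by blast
    then have "\<iota> ` U \<subset> \<iota> ` T" using U by blast
    then have "spherical W' (\<iota> ` U)" using * by blast
    moreover have "U \<subseteq> S" using U assms by blast
    ultimately show "spherical W U" using spherical_image_iff by blast
  next
    fix U' assume *: "\<forall>U. U \<subset> T \<longrightarrow> spherical W U" and U': "U' \<subset> \<iota> ` T"
    then obtain U where U: "U \<subseteq> T" "U' = \<iota> ` U" by (meson psubset_imp_subset subset_image_iff)
    then have "spherical W U" using * U' by blast
    moreover have "U \<subseteq> S" using U assms by blast
    ultimately show "spherical W' U'" unfolding U(2) using spherical_image_iff by blast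
  qed
  then show ?thesis unfolding minimal_nonspherical_def using spherical_image_iff[OF assms] by simp
qed

section \<open>Transport of the hypergraph collections\<close>

lemma maximal_members_image:
  assumes "\<C> \<subseteq> Pow S"
  shows "maximal_members (image \<iota> ` \<C>) = image \<iota> ` maximal_members \<C>"
proof -
  have *: "\<iota> ` T \<subseteq> \<iota> ` U \<longleftrightarrow> T \<subseteq> U" "\<iota> ` U = \<iota> ` T \<longleftrightarrow> U = T"
    if "T \<in> \<C>" "U \<in> \<C>" for T U
  proof -
    have "T \<subseteq> S" "U \<subseteq> S" using that assms by auto
    then show "\<iota> ` T \<subseteq> \<iota> ` U \<longleftrightarrow> T \<subseteq> U" "\<iota> ` U = \<iota> ` T \<longleftrightarrow> U = T"
      by (simp_all add: image_subset_image_iff image_eq_iff)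
  qed
  show ?thesis
  proof
    show "maximal_members (image \<iota> ` \<C>) \<subseteq> image \<iota> ` maximal_members \<C>"
    proof
      fix X assume X: "X \<in> maximal_members (image \<iota> ` \<C>)"
      then obtain T where T: "T \<in> \<C>" "X = \<iota> ` T" by (auto simp: maximal_members_def)
      have "U = T" if U: "U \<in> \<C>" "T \<subseteq> U" for U
      proof -
        have "\<iota> ` T \<subseteq> \<iota> ` U" using U(2) by blast
        then have "\<iota> ` U = \<iota> ` T" using X U(1) T(2) by (simp add: maximal_members_def)
        then show ?thesis using *(2)[OF T(1) U(1)] by simp
      qed
      then have "T \<in> maximal_members \<C>" using T(1) by (simp add: maximal_members_def)
      then show "X \<in> image \<iota> ` maximal_members \<C>" using T(2) by simp
    qed
    show "image \<iota> ` maximal_members \<C> \<subseteq> maximal_members (image \<iota> ` \<C>)"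
    proof
      fix X assume "X \<in> image \<iota> ` maximal_members \<C>"
      then obtain T where T: "T \<in> \<C>" "\<forall>U\<in>\<C>. T \<subseteq> U \<longrightarrow> U = T" "X = \<iota> ` T"
        by (auto simp: maximal_members_def)
      have "\<forall>U\<in>\<C>. \<iota> ` T \<subseteq> \<iota> ` U \<longrightarrow> \<iota> ` U = \<iota> ` T"
      proof (intro ballI impI)
        fix U assume "U \<in> \<C>" "\<iota> ` T \<subseteq> \<iota> ` U"
        then have "U = T" using *(1)[OF T(1)] T(2) by simp
        then show "\<iota> ` U = \<iota> ` T" by simp
      qed
      then show "X \<in> maximal_members (image \<iota> ` \<C>)"
        unfolding T(3) maximal_members_def using T(1) by simp
    qed
  qed
qed

lemma maximal_unions_image:
  assumes P: "\<And>A B. P A B \<Longrightarrow> A \<subseteq> S \<and> B \<subseteq> S" and P': "\<And>A B. P' A B \<Longrightarrow> A \<subseteq> S' \<and> B \<subseteq> S'"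
    and iff: "\<And>A B. A \<subseteq> S \<Longrightarrow> B \<subseteq> S \<Longrightarrow> P' (\<iota> ` A) (\<iota> ` B) \<longleftrightarrow> P A B"
  shows "maximal_members {A \<union> B | A B. P' A B} = image \<iota> ` maximal_members {A \<union> B | A B. P A B}"
proof -
  have "{A \<union> B | A B. P' A B} = image \<iota> ` {A \<union> B | A B. P A B}"
  proof
    show "{A \<union> B | A B. P' A B} \<subseteq> image \<iota> ` {A \<union> B | A B. P A B}"
    proof
      fix X assume "X \<in> {A \<union> B | A B. P' A B}"
      then obtain A' B' where X: "X = A' \<union> B'" "P' A' B'" by blast
      then have "A' \<subseteq> \<iota> ` S" "B' \<subseteq> \<iota> ` S" using P' image_S by auto
      then obtain A B where AB: "A \<subseteq> S" "A' = \<iota> ` A" "B \<subseteq> S" "B' = \<iota> ` B"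
        by (meson subset_image_iff)
      have "X = \<iota> ` (A \<union> B)" using X(1) AB by (simp add: image_Un)
      moreover have "P A B" using iff[OF AB(1,3)] X(2) AB by simp
      ultimately show "X \<in> image \<iota> ` {A \<union> B | A B. P A B}" by blast
    qed
    show "image \<iota> ` {A \<union> B | A B. P A B} \<subseteq> {A \<union> B | A B. P' A B}"
    proof
      fix X assume "X \<in> image \<iota> ` {A \<union> B | A B. P A B}"
      then obtain A B where AB: "X = \<iota> ` (A \<union> B)" "P A B" by blast
      then have "P' (\<iota> ` A) (\<iota> ` B)" using iff[of A B] P[of A B] by simp
      moreover have "X = \<iota> ` A \<union> \<iota> ` B" using AB(1) by (simp add: image_Un)
      ultimately show "X \<in> {A \<union> B | A B. P' A B}" by blast
    qed
  qed
  moreover have "{A \<union> B | A B. P A B} \<subseteq> Pow S" using P by blast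
  ultimately show ?thesis using maximal_members_image by simp
qed

lemma wide_subsets_image: "wide_subsets W' S' = image \<iota> ` wide_subsets W S"
  unfolding wide_subsets_def
proof (rule maximal_unions_image)
  fix A B assume "A \<subseteq> S" "B \<subseteq> S"
  then show "(\<iota> ` A \<subseteq> S' \<and> \<iota> ` B \<subseteq> S' \<and> disjoint_commuting W' (\<iota> ` A) (\<iota> ` B) \<and>
      (\<not> spherical W' (\<iota> ` A) \<and> \<not> spherical W' (\<iota> ` B) \<or>
       irreducible_subset W' (\<iota> ` A) \<and> affine_subset W' (\<iota> ` A) \<and> 3 \<le> card (\<iota> ` A) \<and>
         spherical W' (\<iota> ` B))) \<longleftrightarrow>
    (A \<subseteq> S \<and> B \<subseteq> S \<and> disjoint_commuting W A B \<and>
      (\<not> spherical W A \<and> \<not> spherical W B \<or>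
       irreducible_subset W A \<and> affine_subset W A \<and> 3 \<le> card A \<and> spherical W B))"
    using affine_image_iff[of A]
    by (simp add: image_subset disjoint_commuting_image_iff spherical_image_iff irreducible_image_iff
        card_image_eq) blast
qed simp_all

lemma wide_subsets_Pow: "wide_subsets W S \<subseteq> Pow S"
  unfolding wide_subsets_def maximal_members_def by auto

lemma slab_subsets_Pow: "slab_subsets W S \<subseteq> Pow S"
  unfolding slab_subsets_def maximal_members_def by auto

lemma slab_subsets_image: "slab_subsets W' S' = image \<iota> ` slab_subsets W S"
  unfolding slab_subsets_def
proof (rule maximal_unions_image)
  fix A K assume AK: "A \<subseteq> S" "K \<subseteq> S"
  have "\<iota> ` A \<union> \<iota> ` K \<subseteq> \<iota> ` T \<longleftrightarrow> A \<union> K \<subseteq> T" if "T \<in> wide_subsets W S" for T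
  proof -
    have "T \<subseteq> S" using that wide_subsets_Pow by blast
    then show ?thesis using AK image_subset_image_iff[of "A \<union> K" T] by (simp add: image_Un)
  qed
  then have "(\<exists>T \<in> wide_subsets W' S'. \<iota> ` A \<union> \<iota> ` K \<subseteq> T) \<longleftrightarrow>
      (\<exists>T \<in> wide_subsets W S. A \<union> K \<subseteq> T)"
    by (simp add: wide_subsets_image)
  then show "(\<iota> ` A \<subseteq> S' \<and> \<iota> ` K \<subseteq> S' \<and> disjoint_commuting W' (\<iota> ` A) (\<iota> ` K) \<and>
      minimal_nonspherical W' (\<iota> ` A) \<and> \<iota> ` K \<noteq> {} \<and> spherical W' (\<iota> ` K) \<and>
      \<not> (\<exists>T \<in> wide_subsets W' S'. \<iota> ` A \<union> \<iota> ` K \<subseteq> T)) \<longleftrightarrow>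
    (A \<subseteq> S \<and> K \<subseteq> S \<and> disjoint_commuting W A K \<and>
      minimal_nonspherical W A \<and> K \<noteq> {} \<and> spherical W K \<and>
      \<not> (\<exists>T \<in> wide_subsets W S. A \<union> K \<subseteq> T))"
    using AK by (simp only: image_subset disjoint_commuting_image_iff spherical_image_iff
        minimal_nonspherical_image_iff image_is_empty)
qed simp_all

text \<open>
  A chain in the image collection lifts link by link: intersections commute with the injective map
  \<open>\<iota>\<close>, and sphericity of intersections is preserved.
\<close>

lemma merge_class_image:
  assumes "L \<subseteq> Pow S" "T \<in> L"
  shows "merge_rel W' (image \<iota> ` L) `` {\<iota> ` T} = image \<iota> ` (merge_rel W L `` {T})"
proof -
  define R where "R = {(T, T'). T \<in> L \<and> T' \<in> L \<and> \<not> spherical W (T \<inter> T')}"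
  define R' where "R' = {(T, T'). T \<in> image \<iota> ` L \<and> T' \<in> image \<iota> ` L \<and> \<not> spherical W' (T \<inter> T')}"
  have R_iff: "(\<iota> ` A, \<iota> ` B) \<in> R' \<longleftrightarrow> (A, B) \<in> R" if "A \<in> L" "B \<in> L" for A B
  proof -
    have AB: "A \<subseteq> S" "B \<subseteq> S" using that assms(1) by auto
    have "\<iota> ` A \<inter> \<iota> ` B = \<iota> ` (A \<inter> B)" using inj_on_image_Int[OF inj AB] by simp
    moreover have "A \<inter> B \<subseteq> S" using AB by auto
    ultimately have "spherical W' (\<iota> ` A \<inter> \<iota> ` B) \<longleftrightarrow> spherical W (A \<inter> B)"
      using spherical_image_iff by simp
    then show ?thesis unfolding R_def R'_def using that by auto
  qed
  have lower: "\<exists>U\<in>L. X = \<iota> ` U \<and> (T, U) \<in> R\<^sup>*" if "(\<iota> ` T, X) \<in> R'\<^sup>*" for X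
    using that
  proof (induction rule: rtrancl_induct)
    case base
    then show ?case using assms(2) by blast
  next
    case (step Y Z)
    then obtain U where U: "U \<in> L" "Y = \<iota> ` U" "(T, U) \<in> R\<^sup>*" by blast
    have "Z \<in> image \<iota> ` L" using step.hyps(2) by (auto simp: R'_def)
    then obtain V where V: "V \<in> L" "Z = \<iota> ` V" by blast
    have "(U, V) \<in> R" using step.hyps(2) R_iff U V by simp
    then have "(T, V) \<in> R\<^sup>*" using U(3) by simp
    then show ?case using V by blast
  qed
  have lift: "(\<iota> ` T, \<iota> ` U) \<in> R'\<^sup>* \<and> U \<in> L" if "(T, U) \<in> R\<^sup>*" for U
    using that
  proof (induction rule: rtrancl_induct)
    case base
    then show ?case using assms(2) by simp
  next
    case (step Y Z)
    then have "Z \<in> L" by (auto simp: R_def)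
    then show ?case using step R_iff by (meson rtrancl.rtrancl_into_rtrancl)
  qed
  have "\<iota> ` T \<in> image \<iota> ` L" using assms(2) by simp
  then have classes: "merge_rel W L `` {T} = {U \<in> L. (T, U) \<in> R\<^sup>*}"
    "merge_rel W' (image \<iota> ` L) `` {\<iota> ` T} = {X \<in> image \<iota> ` L. (\<iota> ` T, X) \<in> R'\<^sup>*}"
    unfolding merge_rel_def R_def[symmetric] R'_def[symmetric]
    using assms(2) by (simp_all add: set_eq_iff Image_def conj_commute)
  show ?thesis
    unfolding classes
  proof (intro subset_antisym subsetI)
    fix X assume "X \<in> {X \<in> image \<iota> ` L. (\<iota> ` T, X) \<in> R'\<^sup>*}"
    then obtain U where "U \<in> L" "X = \<iota> ` U" "(T, U) \<in> R\<^sup>*" using lower by blast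
    then show "X \<in> image \<iota> ` {U \<in> L. (T, U) \<in> R\<^sup>*}" by simp
  next
    fix X assume "X \<in> image \<iota> ` {U \<in> L. (T, U) \<in> R\<^sup>*}"
    then obtain U where "X = \<iota> ` U" "(T, U) \<in> R\<^sup>*" by blast
    then show "X \<in> {X \<in> image \<iota> ` L. (\<iota> ` T, X) \<in> R'\<^sup>*}" using lift[of U] by simp
  qed
qed

lemma Lambda_image: "Lambda W' S' k = image \<iota> ` Lambda W S k \<and> Lambda W S k \<subseteq> Pow S"
proof (induction k)
  case 0
  then show ?case
    using wide_subsets_image slab_subsets_image wide_subsets_Pow slab_subsets_Pow by (simp add: image_Un)
next
  case (Suc k)
  define L where "L = Lambda W S k"
  have L: "Lambda W' S' k = image \<iota> ` L" "L \<subseteq> Pow S" using Suc by (auto simp: L_def)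
  have "Lambda W' S' (Suc k) = (\<lambda>T. \<Union> (merge_rel W' (image \<iota> ` L) `` {\<iota> ` T})) ` L"
    by (auto simp: L quotient_def)
  also have "\<dots> = (\<lambda>T. \<iota> ` \<Union> (merge_rel W L `` {T})) ` L"
    using merge_class_image[OF L(2)] by (intro image_cong) (simp_all add: image_Union)
  also have "\<dots> = image \<iota> ` Lambda W S (Suc k)"
    by (auto simp: L_def quotient_def)
  finally have "Lambda W' S' (Suc k) = image \<iota> ` Lambda W S (Suc k)" .
  moreover have "Lambda W S (Suc k) \<subseteq> Pow S"
    using L(2) by (auto simp: L_def[symmetric] quotient_def merge_rel_def)
  ultimately show ?case by blast
qed

lemma bij_betw_image: "\<C> \<subseteq> Pow S \<Longrightarrow> bij_betw (image \<iota>) \<C> (image \<iota> ` \<C>)"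
  unfolding bij_betw_def using inj_on_subset[OF inj_on_image_Pow[OF inj]] by blast

lemma S_in_Lambda_iff: "S' \<in> Lambda W' S' k \<longleftrightarrow> S \<in> Lambda W S k"
proof -
  have "S' \<in> Lambda W' S' k \<longleftrightarrow> \<iota> ` S \<in> image \<iota> ` Lambda W S k"
    by (simp add: Lambda_image image_S)
  also have "\<dots> \<longleftrightarrow> S \<in> Lambda W S k"
    using inj_on_image_mem_iff[OF inj_on_image_Pow[OF inj], of S "Lambda W S k"] Lambda_image by auto
  finally show ?thesis .
qed

lemma hypergraph_index_eq: "hypergraph_index W S = hypergraph_index W' S'"
proof -
  have "S' \<in> Lambda_pred W' S' h \<longleftrightarrow> S \<in> Lambda_pred W S h" for h
    by (simp add: Lambda_pred_def S_in_Lambda_iff split: nat.split)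
  then have "S' \<in> Lambda W' S' h - Lambda_pred W' S' h \<longleftrightarrow> S \<in> Lambda W S h - Lambda_pred W S h" for h
    by (simp add: S_in_Lambda_iff)
  moreover have "wide_subsets W' S' \<noteq> {} \<longleftrightarrow> wide_subsets W S \<noteq> {}"
    by (simp add: wide_subsets_image)
  ultimately show ?thesis unfolding hypergraph_index_def by simp
qed

end

theorem proposition4p23:
  fixes W :: "('a, 'c) monoid_scheme" and W' :: "('b, 'd) monoid_scheme"
    and S :: "'a set" and S' :: "'b set"
    and m :: "'a \<Rightarrow> 'a \<Rightarrow> enat" and m' :: "'b \<Rightarrow> 'b \<Rightarrow> enat"
    and n p q :: nat and s :: "nat \<Rightarrow> 'a" and s' :: "nat \<Rightarrow> 'b" and \<iota> :: "'a \<Rightarrow> 'b"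
  assumes "coxeter_system W S m" and "coxeter_system W' S' m'"
    and "bij_betw s {1..n} S" and "bij_betw s' {1..n} S'"
    and "{(i, j) \<in> {1..n} \<times> {1..n}. m (s i) (s j) \<noteq> m' (s' i) (s' j)} = {(p, q), (q, p)}"
    and "7 \<le> m (s p) (s q)" and "m (s p) (s q) \<noteq> \<infinity>"
    and "7 \<le> m' (s' p) (s' q)" and "m' (s' p) (s' q) \<noteq> \<infinity>"
    and "\<forall>i\<in>{1..n}. \<iota> (s i) = s' i"
  shows "bij_betw (image \<iota>) (wide_subsets W S) (wide_subsets W' S') \<and>
    bij_betw (image \<iota>) (slab_subsets W S) (slab_subsets W' S') \<and>
    (\<forall>k. bij_betw (image \<iota>) (Lambda W S k) (Lambda W' S' k)) \<and>
    hypergraph_index W S = hypergraph_index W' S'"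
proof -
  interpret C: coxeter W S m by unfold_locales fact
  interpret C': coxeter W' S' m' by unfold_locales fact
  have differ: "i \<in> {1..n} \<and> j \<in> {1..n} \<and> m (s i) (s j) \<noteq> m' (s' i) (s' j) \<longleftrightarrow>
      (i, j) = (p, q) \<or> (i, j) = (q, p)" for i j
    using assms(5) by (auto simp: set_eq_iff)
  then have pq: "p \<in> {1..n}" "q \<in> {1..n}" by blast+
  have in_S: "s i \<in> S" if "i \<in> {1..n}" for i using assms(3) that by (auto simp: bij_betw_def)
  have \<iota>: "\<iota> (s i) = s' i" if "i \<in> {1..n}" for i using assms(10) that by blast
  have bij: "bij_betw \<iota> S S'"
  proof -
    have "bij_betw (\<iota> \<circ> s) {1..n} S'"
      using assms(4) bij_betw_cong[of "{1..n}" "\<iota> \<circ> s" s' S'] \<iota> by simp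
    then show ?thesis using bij_betw_comp_iff[OF assms(3), of \<iota> S'] by simp
  qed
  have neq: "s p \<noteq> s q"
    using C.m_self[of "s p"] assms(6) in_S[OF pq(1)] by (auto simp: one_enat_def numeral_eq_enat)
  interpret large_label_change W S m W' S' m' \<iota> "s p" "s q"
  proof unfold_locales
    fix x y assume xy: "x \<in> S" "y \<in> S" "{x, y} \<noteq> {s p, s q}"
    have "S = s ` {1..n}" using assms(3) by (simp add: bij_betw_def)
    then obtain i j where ij: "i \<in> {1..n}" "x = s i" "j \<in> {1..n}" "y = s j"
      using xy(1,2) by blast
    then have "(i, j) \<noteq> (p, q)" "(i, j) \<noteq> (q, p)" using xy(3) by auto
    then show "m' (\<iota> x) (\<iota> y) = m x y" using differ[of i j] ij \<iota> by auto
  qed (use bij pq in_S neq assms(6-9) \<iota> in auto)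
  show ?thesis
    using bij_betw_image wide_subsets_image slab_subsets_image wide_subsets_Pow slab_subsets_Pow
      Lambda_image hypergraph_index_eq by metis
qed

end
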